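(* Let $\varphi:(M^m,g)\to(N^n,h)$ be an almost submersion, $\mathcal{V}=\ker\mathrm{d}\varphi$ and $\mathcal{H}=\mathcal{V}^\perp$, and let $\sigma,\rho$ be nowhere vanishing (positive) smooth functions on $M$. Under the biconformal change of metric $\overline{g}=\sigma^{-2}g^{\mathcal{H}}+\rho^{-2}g^{\mathcal{V}}$, the $\sigma_2$-tension field of $\varphi$ becomes $$\overline{\tau}_{\sigma_2}(\varphi)=\sigma^4\Big\{\tau_{\sigma_2}(\varphi)+2e(\varphi)\,\mathrm{d}\varphi\big(\mathrm{grad}\ln(\sigma^{4-n}\rho^{n-m})\big)-\mathrm{d}\varphi\big(\mathrm{grad}_{\varphi^*h}\ln(\sigma^{4-n}\rho^{n-m})\big)\Big\}.$$ In particular, taking $\sigma=\rho$, for a conformal change of metric $\overline g=\sigma^{-2}g$ one has $$\overline{\tau}_{\sigma_2}(\varphi)=\sigma^4\Big\{\tau_{\sigma_2}(\varphi)+2e(\varphi)\,\mathrm{d}\varphi\big(\mathrm{grad}\ln(\sigma^{4-m})\big)-\mathrm{d}\varphi\big(\mathrm{grad}_{\varphi^*h}\ln(\sigma^{4-m})\big)\Big\}.$$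
   Context: An almost submersion is a smooth map which is a submersion on a dense open subset of $M$; the formula is understood where $\varphi$ is a submersion. $g^{\mathcal H}$, $g^{\mathcal V}$ are the restrictions of $g$ to the horizontal distribution $\mathcal H$ and the vertical distribution $\mathcal V$. The Cauchy-Green tensor is $\mathfrak{C}_\varphi=\mathrm{d}\varphi^t\circ\mathrm{d}\varphi$ ($\varphi^*h$ viewed via $g$ as an endomorphism of $TM$), with eigenvalues $\lambda_k^2$ and corresponding orthonormal eigenvectors $E_k$; the weighted gradient of a function $f$ on $M$ is $\mathrm{grad}_{\varphi^*h}f=\sum_k\lambda_k^2E_k(f)E_k=\mathfrak{C}_\varphi(\mathrm{grad}f)$. $e(\varphi)=\frac12|\mathrm{d}\varphi|^2$, $\tau(\varphi)=\mathrm{trace}\,\nabla\mathrm{d}\varphi$. The $\sigma_2$-tension field with respect to $g$ is $$\tau_{\sigma_2}(\varphi)=2[e(\varphi)\tau(\varphi)+\mathrm{d}\varphi(\mathrm{grad}\,e(\varphi))]-\mathrm{trace}\,(\nabla\mathrm{d}\varphi)\circ\mathfrak{C}_\varphi-\mathrm{d}\varphi(\mathrm{div}\,\mathfrak{C}_\varphi),$$ where, in an orthonormal frame, $\mathrm{trace}\,(\nabla\mathrm{d}\varphi)\circ\mathfrak{C}_\varphi=\sum_i\nabla\mathrm{d}\varphi(e_i,\mathfrak{C}_\varphi e_i)$ and $\mathrm{div}\,\mathfrak{C}_\varphi=\sum_i(\nabla_{e_i}\mathfrak{C}_\varphi)e_i$. $\overline\tau_{\sigma_2}(\varphi)$ is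 the same expression computed with $\overline g$ in place of $g$; on the right-hand sides all quantities ($e$, $\mathrm{grad}$, $\mathrm{grad}_{\varphi^*h}$, $\tau_{\sigma_2}$) are computed with respect to $g$. *)

theory Defs
  imports "HOL-Analysis.Analysis"
begin

section \<open>Smooth maps between open subsets of Euclidean spaces\<close>

primrec Ck_on :: "nat \<Rightarrow> ('a::real_normed_vector \<Rightarrow> 'b::real_normed_vector) \<Rightarrow> 'a set \<Rightarrow> bool" where
  "Ck_on 0 f S \<longleftrightarrow> continuous_on S f"
| "Ck_on (Suc k) f S \<longleftrightarrow>
     (\<forall>x\<in>S. f differentiable (at x)) \<and> (\<forall>v. Ck_on k (\<lambda>x. frechet_derivative f (at x) v) S)"

definition smooth_on :: "('a::real_normed_vector \<Rightarrow> 'b::real_normed_vector) \<Rightarrow> 'a set \<Rightarrow> bool" where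
  "smooth_on f S \<longleftrightarrow> open S \<and> (\<forall>k. Ck_on k f S)"


section \<open>Smooth manifolds and smooth maps\<close>

text \<open>A chart is a domain together with a coordinate map; the coordinate map is only relevant on
  its domain. The dimension of the manifold is the cardinality of the finite index type.\<close>

type_synonym ('a, 'm) chart = "'a set \<times> ('a \<Rightarrow> real^'m)"

definition chart_image :: "('a, 'm::finite) chart \<Rightarrow> (real^'m) set" where
  "chart_image c = snd c ` fst c"

definition chart_inv :: "('a, 'm::finite) chart \<Rightarrow> real^'m \<Rightarrow> 'a" where
  "chart_inv c = inv_into (fst c) (snd c)"

definition is_chart :: "'a topology \<Rightarrow> ('a, 'm::finite) chart \<Rightarrow> bool" where
  "is_chart X c \<longleftrightarrow> openin X (fst c) \<and> open (chart_image c) \<and>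
     homeomorphic_map (subtopology X (fst c)) (top_of_set (chart_image c)) (snd c)"

definition smooth_manifold :: "'a topology \<Rightarrow> ('a, 'm::finite) chart set \<Rightarrow> bool" where
  "smooth_manifold X A \<longleftrightarrow>
     Hausdorff_space X \<and> second_countable X \<and>
     (\<forall>c\<in>A. is_chart X c) \<and> topspace X = \<Union>(fst ` A) \<and>
     (\<forall>c\<in>A. \<forall>d\<in>A. smooth_on (snd d \<circ> chart_inv c) (snd c ` (fst c \<inter> fst d)))"

definition charts_at :: "('a, 'm::finite) chart set \<Rightarrow> 'a \<Rightarrow> ('a, 'm) chart set" where
  "charts_at A p = {c \<in> A. p \<in> fst c}"

definition smooth_function :: "('a, 'm::finite) chart set \<Rightarrow> ('a \<Rightarrow> real) \<Rightarrow> bool" where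
  "smooth_function A f \<longleftrightarrow> (\<forall>c\<in>A. smooth_on (f \<circ> chart_inv c) (chart_image c))"

definition local_rep ::
  "('a, 'm::finite) chart \<Rightarrow> ('b, 'n::finite) chart \<Rightarrow> ('a \<Rightarrow> 'b) \<Rightarrow> real^'m \<Rightarrow> real^'n" where
  "local_rep c d \<phi> = snd d \<circ> \<phi> \<circ> chart_inv c"

definition smooth_map ::
  "'a topology \<Rightarrow> ('a, 'm::finite) chart set \<Rightarrow> 'b topology \<Rightarrow> ('b, 'n::finite) chart set
    \<Rightarrow> ('a \<Rightarrow> 'b) \<Rightarrow> bool" where
  "smooth_map X A Y B \<phi> \<longleftrightarrow> continuous_map X Y \<phi> \<and>
     (\<forall>c\<in>A. \<forall>d\<in>B. smooth_on (local_rep c d \<phi>) (snd c ` {p \<in> fst c. \<phi> p \<in> fst d}))"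

definition submersion_at ::
  "('a, 'm::finite) chart set \<Rightarrow> ('b, 'n::finite) chart set \<Rightarrow> ('a \<Rightarrow> 'b) \<Rightarrow> 'a \<Rightarrow> bool" where
  "submersion_at A B \<phi> p \<longleftrightarrow>
     (\<forall>c\<in>charts_at A p. \<forall>d\<in>charts_at B (\<phi> p).
        surj (frechet_derivative (local_rep c d \<phi>) (at (snd c p))))"

definition almost_submersion ::
  "'a topology \<Rightarrow> ('a, 'm::finite) chart set \<Rightarrow> 'b topology \<Rightarrow> ('b, 'n::finite) chart set
    \<Rightarrow> ('a \<Rightarrow> 'b) \<Rightarrow> bool" where
  "almost_submersion X A Y B \<phi> \<longleftrightarrow> smooth_map X A Y B \<phi> \<and>
     (\<exists>U. openin X U \<and> X closure_of U = topspace X \<and> (\<forall>p\<in>U. submersion_at A B \<phi> p))"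


section \<open>Riemannian metrics\<close>

text \<open>Tensor fields are given by their components in the charts: \<open>g c x\<close> is the Gram matrix of the
  metric in the coordinate frame of the chart \<open>c\<close>, at the point with coordinates \<open>x\<close>.\<close>

type_synonym ('a, 'm) metric = "('a, 'm) chart \<Rightarrow> real^'m \<Rightarrow> real^'m^'m"

definition form :: "real^'m^'m \<Rightarrow> real^'m \<Rightarrow> real^'m::finite \<Rightarrow> real" where
  "form S u v = u \<bullet> (S *v v)"

definition riemannian_manifold ::
  "'a topology \<Rightarrow> ('a, 'm::finite) chart set \<Rightarrow> ('a, 'm) metric \<Rightarrow> bool" where
  "riemannian_manifold X A g \<longleftrightarrow> smooth_manifold X A \<and>
     (\<forall>c\<in>A. smooth_on (g c) (chart_image c) \<and>
        (\<forall>x\<in>chart_image c. transpose (g c x) = g c x \<and> (\<forall>v. v \<noteq> 0 \<longrightarrow> form (g c x) v v > 0))) \<and>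
     (\<forall>c\<in>A. \<forall>d\<in>A. \<forall>p\<in>fst c \<inter> fst d.
        (let J = jacobian (snd d \<circ> chart_inv c) (at (snd c p))
         in g c (snd c p) = transpose J ** g d (snd d p) ** J))"


section \<open>Riemannian geometry in coordinates\<close>

text \<open>In this section \<open>G\<close> and \<open>H\<close> are Gram matrices of metrics on open subsets of the Euclidean
  spaces of dimension \<open>m\<close> and \<open>n\<close>, and \<open>f\<close> is a map between these subsets.\<close>

definition orthonormal_basis :: "real^'m^'m \<Rightarrow> ('m::finite \<Rightarrow> real^'m) \<Rightarrow> bool" where
  "orthonormal_basis S e \<longleftrightarrow> (\<forall>i j. form S (e i) (e j) = (if i = j then 1 else 0))"

text \<open>The frame is only used to take traces of bilinear maps; these do not depend on its choice.\<close>

definition frame :: "real^'m^'m \<Rightarrow> 'm::finite \<Rightarrow> real^'m" where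
  "frame S = (SOME e. orthonormal_basis S e)"

definition partial :: "'m \<Rightarrow> (real^'m::finite \<Rightarrow> real) \<Rightarrow> real^'m \<Rightarrow> real" where
  "partial i k x = frechet_derivative k (at x) (axis i 1)"

definition gradient ::
  "(real^'m \<Rightarrow> real^'m^'m) \<Rightarrow> (real^'m::finite \<Rightarrow> real) \<Rightarrow> real^'m \<Rightarrow> real^'m" where
  "gradient G k x = matrix_inv (G x) *v (\<chi> i. partial i k x)"

definition christoffel_symbol ::
  "(real^'m::finite \<Rightarrow> real^'m^'m) \<Rightarrow> real^'m \<Rightarrow> 'm \<Rightarrow> 'm \<Rightarrow> 'm \<Rightarrow> real" where
  "christoffel_symbol G x k i j =
     (\<Sum>l\<in>UNIV. matrix_inv (G x) $ k $ l *
        (partial i (\<lambda>y. G y $ j $ l) x + partial j (\<lambda>y. G y $ i $ l) x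
          - partial l (\<lambda>y. G y $ i $ j) x)) / 2"

definition christoffel ::
  "(real^'m::finite \<Rightarrow> real^'m^'m) \<Rightarrow> real^'m \<Rightarrow> real^'m \<Rightarrow> real^'m \<Rightarrow> real^'m" where
  "christoffel G x u v =
     (\<chi> k. \<Sum>i\<in>UNIV. \<Sum>j\<in>UNIV. christoffel_symbol G x k i j * u $ i * v $ j)"

text \<open>The Levi-Civita covariant derivative of the vector field \<open>V\<close> in the direction \<open>u\<close>, and the
  pull-back covariant derivative of a vector field \<open>W\<close> along \<open>f\<close>.\<close>

definition cov_deriv ::
  "(real^'m::finite \<Rightarrow> real^'m^'m) \<Rightarrow> (real^'m \<Rightarrow> real^'m) \<Rightarrow> real^'m \<Rightarrow> real^'m \<Rightarrow> real^'m" where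
  "cov_deriv G V x u = frechet_derivative V (at x) u + christoffel G x u (V x)"

definition cov_deriv_along ::
  "(real^'n::finite \<Rightarrow> real^'n^'n) \<Rightarrow> (real^'m::finite \<Rightarrow> real^'n) \<Rightarrow> (real^'m \<Rightarrow> real^'n)
    \<Rightarrow> real^'m \<Rightarrow> real^'m \<Rightarrow> real^'n" where
  "cov_deriv_along H f W x u =
     frechet_derivative W (at x) u + christoffel H (f x) (jacobian f (at x) *v u) (W x)"

text \<open>The tensors \<open>(\<nabla>df)(u, v)\<close> and \<open>(\<nabla>\<^sub>u C) v\<close>, obtained by extending \<open>v\<close> to the
  vector field with constant components.\<close>

definition nabla_d ::
  "(real^'m::finite \<Rightarrow> real^'m^'m) \<Rightarrow> (real^'n::finite \<Rightarrow> real^'n^'n) \<Rightarrow> (real^'m \<Rightarrow> real^'n)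
    \<Rightarrow> real^'m \<Rightarrow> real^'m \<Rightarrow> real^'m \<Rightarrow> real^'n" where
  "nabla_d G H f x u v =
     cov_deriv_along H f (\<lambda>y. jacobian f (at y) *v v) x u - jacobian f (at x) *v cov_deriv G (\<lambda>_. v) x u"

definition nabla_endo ::
  "(real^'m::finite \<Rightarrow> real^'m^'m) \<Rightarrow> (real^'m \<Rightarrow> real^'m^'m) \<Rightarrow> real^'m \<Rightarrow> real^'m \<Rightarrow> real^'m
    \<Rightarrow> real^'m" where
  "nabla_endo G C x u v = cov_deriv G (\<lambda>y. C y *v v) x u - C x *v cov_deriv G (\<lambda>_. v) x u"

definition divergence_endo ::
  "(real^'m::finite \<Rightarrow> real^'m^'m) \<Rightarrow> (real^'m \<Rightarrow> real^'m^'m) \<Rightarrow> real^'m \<Rightarrow> real^'m" where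
  "divergence_endo G C x = (\<Sum>i\<in>UNIV. nabla_endo G C x (frame (G x) i) (frame (G x) i))"

text \<open>The adjoint of \<open>df\<close> at \<open>x\<close>, i.e. the linear map \<open>L\<close> with \<open>G(L w, v) = H(w, df v)\<close>.\<close>

definition d_adjoint ::
  "(real^'m::finite \<Rightarrow> real^'m^'m) \<Rightarrow> (real^'n::finite \<Rightarrow> real^'n^'n) \<Rightarrow> (real^'m \<Rightarrow> real^'n)
    \<Rightarrow> real^'m \<Rightarrow> real^'n^'m" where
  "d_adjoint G H f x = matrix_inv (G x) ** transpose (jacobian f (at x)) ** H (f x)"

definition cauchy_green ::
  "(real^'m::finite \<Rightarrow> real^'m^'m) \<Rightarrow> (real^'n::finite \<Rightarrow> real^'n^'n) \<Rightarrow> (real^'m \<Rightarrow> real^'n)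
    \<Rightarrow> real^'m \<Rightarrow> real^'m^'m" where
  "cauchy_green G H f x = d_adjoint G H f x ** jacobian f (at x)"

definition energy_density ::
  "(real^'m::finite \<Rightarrow> real^'m^'m) \<Rightarrow> (real^'n::finite \<Rightarrow> real^'n^'n) \<Rightarrow> (real^'m \<Rightarrow> real^'n)
    \<Rightarrow> real^'m \<Rightarrow> real" where
  "energy_density G H f x =
     (\<Sum>i\<in>UNIV. form (H (f x)) (jacobian f (at x) *v frame (G x) i) (jacobian f (at x) *v frame (G x) i)) / 2"

definition tension ::
  "(real^'m::finite \<Rightarrow> real^'m^'m) \<Rightarrow> (real^'n::finite \<Rightarrow> real^'n^'n) \<Rightarrow> (real^'m \<Rightarrow> real^'n)
    \<Rightarrow> real^'m \<Rightarrow> real^'n" where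
  "tension G H f x = (\<Sum>i\<in>UNIV. nabla_d G H f x (frame (G x) i) (frame (G x) i))"

definition sigma2_tension ::
  "(real^'m::finite \<Rightarrow> real^'m^'m) \<Rightarrow> (real^'n::finite \<Rightarrow> real^'n^'n) \<Rightarrow> (real^'m \<Rightarrow> real^'n)
    \<Rightarrow> real^'m \<Rightarrow> real^'n" where
  "sigma2_tension G H f x =
     2 *\<^sub>R (energy_density G H f x *\<^sub>R tension G H f x
            + jacobian f (at x) *v gradient G (energy_density G H f) x)
     - (\<Sum>i\<in>UNIV. nabla_d G H f x (frame (G x) i) (cauchy_green G H f x *v frame (G x) i))
     - jacobian f (at x) *v divergence_endo G (cauchy_green G H f) x"

text \<open>The gradient weighted by the pull-back of \<open>H\<close> under \<open>f\<close>.\<close>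

definition weighted_gradient ::
  "(real^'m::finite \<Rightarrow> real^'m^'m) \<Rightarrow> (real^'n::finite \<Rightarrow> real^'n^'n) \<Rightarrow> (real^'m \<Rightarrow> real^'n)
    \<Rightarrow> (real^'m \<Rightarrow> real) \<Rightarrow> real^'m \<Rightarrow> real^'m" where
  "weighted_gradient G H f k x = cauchy_green G H f x *v gradient G k x"


section \<open>Conformal and biconformal changes of metric\<close>

text \<open>The vertical and the horizontal space of \<open>\<phi>\<close> at \<open>p\<close>, in the coordinates of the chart \<open>c\<close>.\<close>

definition vertical ::
  "('b, 'n::finite) chart set \<Rightarrow> ('a \<Rightarrow> 'b) \<Rightarrow> ('a, 'm::finite) chart \<Rightarrow> 'a \<Rightarrow> (real^'m) set" where
  "vertical B \<phi> c p =
     {v. \<forall>d\<in>charts_at B (\<phi> p). frechet_derivative (local_rep c d \<phi>) (at (snd c p)) v = 0}"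

definition horizontal ::
  "('b, 'n::finite) chart set \<Rightarrow> ('a \<Rightarrow> 'b) \<Rightarrow> ('a, 'm::finite) metric \<Rightarrow> ('a, 'm) chart \<Rightarrow> 'a
    \<Rightarrow> (real^'m) set" where
  "horizontal B \<phi> g c p = {u. \<forall>v\<in>vertical B \<phi> c p. form (g c (snd c p)) u v = 0}"

definition vertical_part ::
  "('b, 'n::finite) chart set \<Rightarrow> ('a \<Rightarrow> 'b) \<Rightarrow> ('a, 'm::finite) metric \<Rightarrow> ('a, 'm) chart \<Rightarrow> 'a
    \<Rightarrow> real^'m \<Rightarrow> real^'m" where
  "vertical_part B \<phi> g c p u =
     (THE w. w \<in> vertical B \<phi> c p \<and> u - w \<in> horizontal B \<phi> g c p)"

definition horizontal_part ::
  "('b, 'n::finite) chart set \<Rightarrow> ('a \<Rightarrow> 'b) \<Rightarrow> ('a, 'm::finite) metric \<Rightarrow> ('a, 'm) chart \<Rightarrow> 'a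
    \<Rightarrow> real^'m \<Rightarrow> real^'m" where
  "horizontal_part B \<phi> g c p u = u - vertical_part B \<phi> g c p u"

definition biconformal_metric ::
  "('b, 'n::finite) chart set \<Rightarrow> ('a \<Rightarrow> 'b) \<Rightarrow> ('a \<Rightarrow> real) \<Rightarrow> ('a \<Rightarrow> real) \<Rightarrow> ('a, 'm::finite) metric
    \<Rightarrow> ('a, 'm) metric" where
  "biconformal_metric B \<phi> \<sigma> \<rho> g c x =
     (let p = chart_inv c x; hor = horizontal_part B \<phi> g c p; ver = vertical_part B \<phi> g c p
      in \<chi> i j. \<sigma> p powi (-2) * form (g c x) (hor (axis i 1)) (hor (axis j 1))
             + \<rho> p powi (-2) * form (g c x) (ver (axis i 1)) (ver (axis j 1)))"

definition conformal_metric ::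
  "('a \<Rightarrow> real) \<Rightarrow> ('a, 'm::finite) metric \<Rightarrow> ('a, 'm) metric" where
  "conformal_metric \<sigma> g c x = \<sigma> (chart_inv c x) powi (-2) *\<^sub>R g c x"

end

theory Submission
  imports Defs
begin

text \<open>In coordinates, with \<open>J\<close> the Jacobian, \<open>P = G\<inverse>\<close> and the contravariant stress
  \<open>S = 2 e P - C P\<close>, the \<open>\<sigma>\<^sub>2\<close>-tension field has the divergence form
  \<open>\<Sum>\<^sub>a (\<partial>\<^sub>a (J S) e\<^sub>a + \<Gamma>\<^sup>H (J e\<^sub>a, J S e\<^sub>a)) + J S d(ln \<surd>(det G))\<close>,
  in which second derivatives of the map enter only through \<open>J S\<close>. Under the biconformal
  change of metric \<open>J P\<close> is multiplied by \<open>\<sigma>\<^sup>2\<close>, because \<open>J\<close> annihilates the vertical part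
  of \<open>P\<close>; hence \<open>e\<close> and \<open>C\<close> scale by \<open>\<sigma>\<^sup>2\<close> and \<open>J S\<close> by \<open>\<sigma>\<^sup>4\<close>, while the volume density scales by
  \<open>\<sigma>\<^sup>-\<^sup>n \<rho>\<^sup>n\<^sup>-\<^sup>m\<close>. Differentiating these two factors produces \<open>J S d(ln (\<sigma>\<^sup>4\<^sup>-\<^sup>n \<rho>\<^sup>n\<^sup>-\<^sup>m))\<close>, which is the
  correction term.\<close>

section \<open>Calculus of matrix-valued functions\<close>

lemma
  fixes A :: "real^'n^'n"
  assumes "invertible A"
  shows matrix_inv_right: "A ** matrix_inv A = mat 1"
    and matrix_inv_left: "matrix_inv A ** A = mat 1"
proof -
  have "A ** matrix_inv A = mat 1 \<and> matrix_inv A ** A = mat 1"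
    unfolding matrix_inv_def by (rule someI_ex) (use assms in \<open>simp add: invertible_def\<close>)
  then show "A ** matrix_inv A = mat 1" "matrix_inv A ** A = mat 1" by auto
qed

lemma matrix_inv_eqI:
  fixes A B :: "real^'n^'n"
  assumes "A ** B = mat 1"
  shows "matrix_inv A = B"
proof -
  have "invertible A"
    using assms by (auto simp: invertible_right_inverse)
  then have "matrix_inv A ** (A ** B) = B"
    by (simp add: matrix_mul_assoc matrix_inv_left)
  then show ?thesis using assms by simp
qed

section \<open>Linear operations on matrices and their derivatives\<close>

lemma bounded_bilinear_matrix_mult:
  "bounded_bilinear ((**) :: real^'n^'m \<Rightarrow> real^'p^'n \<Rightarrow> real^'p^'m)"
  unfolding bilinear_conv_bounded_bilinear[symmetric] bilinear_def
  by (auto intro!: linearI simp: matrix_matrix_mult_def vec_eq_iff sum.distrib sum_distrib_left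
      algebra_simps)

lemma bounded_bilinear_matrix_vector_mult:
  "bounded_bilinear ((*v) :: real^'n^'m \<Rightarrow> real^'n \<Rightarrow> real^'m)"
  unfolding bilinear_conv_bounded_bilinear[symmetric] bilinear_def
  by (auto intro!: linearI simp: matrix_vector_mult_def vec_eq_iff sum.distrib sum_distrib_left
      algebra_simps)

lemmas has_derivative_matrix_mult = bounded_bilinear.FDERIV[OF bounded_bilinear_matrix_mult]
lemmas has_derivative_matrix_vector_mult =
  bounded_bilinear.FDERIV[OF bounded_bilinear_matrix_vector_mult]

lemma bounded_linear_transpose: "bounded_linear (transpose :: real^'n^'m \<Rightarrow> real^'m^'n)"
  unfolding linear_conv_bounded_linear[symmetric]
  by (auto intro!: linearI simp: transpose_def vec_eq_iff)

lemma bounded_linear_trace: "bounded_linear (trace :: real^'n^'n \<Rightarrow> real)"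
  unfolding linear_conv_bounded_linear[symmetric]
  by (auto intro!: linearI simp: trace_def sum.distrib sum_distrib_left)

lemma bounded_linear_entry: "bounded_linear (\<lambda>A :: real^'n^'m. A $ i $ j)"
  unfolding linear_conv_bounded_linear[symmetric]
  by (auto intro!: linearI)

lemma differentiable_matrix_mult:
  fixes A :: "'a::real_normed_vector \<Rightarrow> real^'n^'m"
  assumes "A differentiable (at x)" "B differentiable (at x)"
  shows "(\<lambda>y. A y ** B y) differentiable (at x)"
  using assms has_derivative_matrix_mult unfolding differentiable_def by blast

lemma differentiable_transpose:
  fixes A :: "'a::real_normed_vector \<Rightarrow> real^'n^'m"
  assumes "A differentiable (at x)"
  shows "(\<lambda>y. transpose (A y)) differentiable (at x)"
  using assms bounded_linear.has_derivative[OF bounded_linear_transpose]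
  unfolding differentiable_def by blast

lemma differentiable_trace:
  fixes A :: "'a::real_normed_vector \<Rightarrow> real^'n^'n"
  assumes "A differentiable (at x)"
  shows "(\<lambda>y. trace (A y)) differentiable (at x)"
  using assms bounded_linear.has_derivative[OF bounded_linear_trace]
  unfolding differentiable_def by blast

lemma differentiable_entry:
  fixes A :: "'a::real_normed_vector \<Rightarrow> real^'n^'m"
  assumes "A differentiable (at x)"
  shows "(\<lambda>y. A y $ i $ j) differentiable (at x)"
  using assms bounded_linear.has_derivative[OF bounded_linear_entry]
  unfolding differentiable_def by blast

lemma differentiable_vec_lambda:
  fixes F :: "'a::real_normed_vector \<Rightarrow> 'n::finite \<Rightarrow> 'b::euclidean_space"
  assumes "\<And>i. (\<lambda>y. F y i) differentiable (at x)"
  shows "(\<lambda>y. \<chi> i. F y i) differentiable (at x)"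
proof -
  have "((\<lambda>y. \<chi> i. F y i) has_derivative (\<lambda>h. \<chi> i. frechet_derivative (\<lambda>y. F y i) (at x) h)) (at x)"
    unfolding has_derivative_componentwise_within[of "\<lambda>y. \<chi> i. F y i"]
    using assms[unfolded frechet_derivative_works]
    by (auto simp: Basis_vec_def inner_axis intro!: derivative_intros)
  then show ?thesis by (rule differentiableI)
qed

section \<open>Determinants and inverses\<close>

lemma differentiable_det:
  fixes A :: "'a::real_normed_vector \<Rightarrow> real^'n^'n"
  assumes "\<And>i j. (\<lambda>y. A y $ i $ j) differentiable (at x)"
  shows "(\<lambda>y. det (A y)) differentiable (at x)"
proof -
  have prod: "(\<lambda>y. \<Prod>i\<in>UNIV. A y $ i $ p i) differentiable (at x)" for p
  proof -
    from has_derivative_prod[OF assms[unfolded frechet_derivative_works]] show ?thesis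
      by (rule differentiableI)
  qed
  show ?thesis
    unfolding det_def
  proof (rule differentiable_sum, simp, rule ballI)
    fix p
    show "(\<lambda>y. of_int (sign p) * (\<Prod>i\<in>UNIV. A y $ i $ p i)) differentiable (at x)"
      by (rule differentiable_mult[OF differentiable_const prod])
  qed
qed

text \<open>Column \<open>l\<close> of the inverse solves \<open>A *v z = axis l 1\<close>, so
  Cramer's rule gives its entries. They are quotients of determinants, which is how
  differentiability of the inverse is obtained.\<close>

lemma matrix_inv_cramer:
  fixes A :: "real^'n^'n"
  assumes "det A \<noteq> 0"
  shows "matrix_inv A = (\<chi> k l. det (\<chi> i j. if j = k then axis l 1 $ i else A $ i $ j) / det A)"
proof (rule matrix_inv_eqI, subst matrix_eq, rule allI)
  fix v
  have inv: "invertible A" using assms by (simp add: invertible_det_nz)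
  have "A *v (matrix_inv A *v axis l 1) = axis l 1" for l
    by (simp add: matrix_vector_mul_assoc matrix_inv_right[OF inv])
  then have "matrix_inv A *v axis l 1
      = (\<chi> k. det (\<chi> i j. if j = k then axis l 1 $ i else A $ i $ j) / det A)" for l
    by (simp only: cramer[OF assms])
  then have "(\<chi> k l. det (\<chi> i j. if j = k then axis l 1 $ i else A $ i $ j) / det A) = matrix_inv A"
    by (simp add: vec_eq_iff matrix_vector_mult_basis column_def)
  then show "A ** (\<chi> k l. det (\<chi> i j. if j = k then axis l 1 $ i else A $ i $ j) / det A) *v v
      = mat 1 *v v"
    by (simp add: matrix_inv_right[OF inv])
qed

text \<open>The determinant is continuous and nonzero at \<open>x\<close>.\<close>

lemma eventually_invertible:
  fixes A :: "'a::real_normed_vector \<Rightarrow> real^'n^'n"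
  assumes "A differentiable (at x)" "invertible (A x)"
  shows "\<forall>\<^sub>F y in nhds x. invertible (A y)"
proof -
  have "(\<lambda>y. det (A y)) differentiable (at x)"
    by (intro differentiable_det differentiable_entry assms)
  then have "isCont (\<lambda>y. det (A y)) x"
    by (rule differentiable_imp_continuous_within)
  then have "((\<lambda>y. det (A y)) \<longlongrightarrow> det (A x)) (nhds x)"
    unfolding isCont_def by (rule tendsto_at_iff_tendsto_nhds[THEN iffD1])
  then have "\<forall>\<^sub>F y in nhds x. det (A y) \<noteq> 0"
    by (rule tendsto_imp_eventually_ne) (use assms(2) in \<open>simp add: invertible_det_nz\<close>)
  then show ?thesis by eventually_elim (simp add: invertible_det_nz)
qed

text \<open>Derivatives depend on germs only. Identities known merely near the base point, such as
  those on a chart domain, are differentiated through this rule.\<close>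

lemma has_derivative_transform_nhds:
  assumes "(f has_derivative D) (at x)" "\<forall>\<^sub>F y in nhds x. f y = g y"
  shows "(g has_derivative D) (at x)"
proof (rule has_derivative_transform_eventually[OF assms(1)])
  show "\<forall>\<^sub>F y in at x. f y = g y"
    unfolding eventually_at_filter using assms(2) by eventually_elim simp
  show "f x = g x" using assms(2) by (rule eventually_nhds_x_imp_x)
qed simp

lemma differentiable_transform_nhds:
  assumes "f differentiable (at x)" "\<forall>\<^sub>F y in nhds x. f y = g y"
  shows "g differentiable (at x)"
  using assms has_derivative_transform_nhds unfolding differentiable_def by blast

lemma differentiable_matrix_inv:
  fixes A :: "'a::real_normed_vector \<Rightarrow> real^'n^'n"
  assumes "A differentiable (at x)" "invertible (A x)"
  shows "(\<lambda>y. matrix_inv (A y)) differentiable (at x)"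
proof (rule differentiable_transform_nhds)
  have "(\<lambda>y. det (A y)) differentiable (at x)"
    by (intro differentiable_det differentiable_entry assms)
  moreover have "(\<lambda>y. det (\<chi> i j. if j = k then axis l 1 $ i else A y $ i $ j)) differentiable (at x)" for k l
  proof (rule differentiable_det)
    fix i j
    show "(\<lambda>y. (\<chi> i j. if j = k then axis l 1 $ i else A y $ i $ j) $ i $ j) differentiable (at x)"
      using differentiable_entry[OF assms(1), of i j] by (cases "j = k") simp_all
  qed
  moreover have "det (A x) \<noteq> 0" using assms(2) by (simp add: invertible_det_nz)
  ultimately have "(\<lambda>y. det (\<chi> i j. if j = k then axis l 1 $ i else A y $ i $ j) / det (A y))
      differentiable (at x)" for k l
    by (intro differentiable_divide)
  then show "(\<lambda>y. \<chi> k l. det (\<chi> i j. if j = k then axis l 1 $ i else A y $ i $ j) / det (A y))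
      differentiable (at x)"
    by (rule differentiable_vec_lambda[OF differentiable_vec_lambda])
  show "\<forall>\<^sub>F y in nhds x. (\<chi> k l. det (\<chi> i j. if j = k then axis l 1 $ i else A y $ i $ j) / det (A y))
      = matrix_inv (A y)"
    using eventually_invertible[OF assms]
    by eventually_elim (rule matrix_inv_cramer[symmetric], simp add: invertible_det_nz)
qed

text \<open>Differentiate \<open>A y ** matrix_inv (A y) = mat 1\<close>, which holds near
  \<open>x\<close>, and multiply by the inverse from the left. Existence of the derivative
  \<open>D'\<close> has to be known first and comes from Cramer's rule.\<close>

lemma has_derivative_matrix_inv:
  fixes A :: "'a::real_normed_vector \<Rightarrow> real^'n^'n"
  assumes "(A has_derivative D) (at x)" "invertible (A x)"
  shows "((\<lambda>y. matrix_inv (A y)) has_derivative (\<lambda>h. - (matrix_inv (A x) ** D h ** matrix_inv (A x)))) (at x)"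
proof -
  have "A differentiable (at x)" using assms(1) by (rule differentiableI)
  from differentiable_matrix_inv[OF this assms(2)] obtain D' where
    D': "((\<lambda>y. matrix_inv (A y)) has_derivative D') (at x)" unfolding differentiable_def by blast
  have "((\<lambda>y. A y ** matrix_inv (A y)) has_derivative (\<lambda>h. A x ** D' h + D h ** matrix_inv (A x))) (at x)"
    by (rule has_derivative_matrix_mult[OF assms(1) D'])
  then have "((\<lambda>y. mat 1) has_derivative (\<lambda>h. A x ** D' h + D h ** matrix_inv (A x))) (at x)"
    by (rule has_derivative_transform_nhds)
       (use eventually_invertible[OF \<open>A differentiable _\<close> assms(2)] in \<open>rule eventually_mono\<close>, rule matrix_inv_right)
  from has_derivative_unique[OF this has_derivative_const]
  have "A x ** D' h = - (D h ** matrix_inv (A x))" for h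
    by (auto simp: fun_eq_iff eq_neg_iff_add_eq_0)
  then have "matrix_inv (A x) ** (A x ** D' h) = - (matrix_inv (A x) ** D h ** matrix_inv (A x))" for h
    by (simp add: matrix_mul_assoc[symmetric] bounded_bilinear.minus_right[OF bounded_bilinear_matrix_mult])
  then have "D' = (\<lambda>h. - (matrix_inv (A x) ** D h ** matrix_inv (A x)))"
    by (auto simp: matrix_mul_assoc matrix_inv_left[OF assms(2)])
  with D' show ?thesis by simp
qed

section \<open>The divergence form of the tension field\<close>

lemmas matrix_mult_linear_simps =
  bounded_bilinear.add_left[OF bounded_bilinear_matrix_mult]
  bounded_bilinear.add_right[OF bounded_bilinear_matrix_mult]
  bounded_bilinear.diff_left[OF bounded_bilinear_matrix_mult]
  bounded_bilinear.diff_right[OF bounded_bilinear_matrix_mult]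
  bounded_bilinear.minus_left[OF bounded_bilinear_matrix_mult]
  bounded_bilinear.minus_right[OF bounded_bilinear_matrix_mult]
  bounded_bilinear.scaleR_left[OF bounded_bilinear_matrix_mult]
  bounded_bilinear.scaleR_right[OF bounded_bilinear_matrix_mult]

lemmas matrix_vector_mult_linear_simps =
  bounded_bilinear.add_left[OF bounded_bilinear_matrix_vector_mult]
  bounded_bilinear.add_right[OF bounded_bilinear_matrix_vector_mult]
  bounded_bilinear.diff_left[OF bounded_bilinear_matrix_vector_mult]
  bounded_bilinear.diff_right[OF bounded_bilinear_matrix_vector_mult]
  bounded_bilinear.minus_left[OF bounded_bilinear_matrix_vector_mult]
  bounded_bilinear.minus_right[OF bounded_bilinear_matrix_vector_mult]
  bounded_bilinear.scaleR_left[OF bounded_bilinear_matrix_vector_mult]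
  bounded_bilinear.scaleR_right[OF bounded_bilinear_matrix_vector_mult]

section \<open>Positive definite matrices and traces in orthonormal frames\<close>

definition spd :: "real^'m^'m \<Rightarrow> bool" where
  "spd S \<longleftrightarrow> transpose S = S \<and> (\<forall>v. v \<noteq> 0 \<longrightarrow> form S v v > 0)"

lemma form_eq_sum: "form S u v = (\<Sum>a\<in>UNIV. \<Sum>b\<in>UNIV. S $ a $ b * u $ a * v $ b)"
  by (simp add: form_def inner_vec_def matrix_vector_mult_def sum_distrib_left mult_ac)

lemma bilinear_form: "bilinear (form S)"
  unfolding bilinear_def form_def
  by (auto intro!: linearI simp: inner_add_left inner_add_right matrix_vector_mult_linear_simps)

lemma form_commute: "transpose S = S \<Longrightarrow> form S u v = form S v u"
  unfolding form_def by (metis dot_lmul_matrix inner_commute vector_transpose_matrix)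

lemma spd_invertible:
  assumes "spd S"
  shows "invertible S"
proof -
  have "S *v v = 0 \<Longrightarrow> v = 0" for v
    using assms unfolding spd_def form_def by (metis inner_zero_right less_irrefl)
  then show ?thesis by (auto simp: invertible_left_inverse matrix_left_invertible_ker)
qed

lemma transpose_matrix_inv:
  fixes S :: "real^'m^'m"
  assumes "invertible S" "transpose S = S"
  shows "transpose (matrix_inv S) = matrix_inv S"
proof -
  have "S ** transpose (matrix_inv S) = transpose (matrix_inv S ** S)"
    by (simp add: matrix_transpose_mul assms(2))
  then show ?thesis by (metis assms(1) matrix_inv_eqI matrix_inv_left transpose_mat)
qed

text \<open>Gram-Schmidt, by induction over the finite index set. It guarantees that the choice in
  \<open>frame\<close> picks an orthonormal basis.\<close>

lemma orthonormal_basis_exists: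
  fixes S :: "real^'m^'m"
  assumes "spd S"
  shows "\<exists>e. orthonormal_basis S e"
proof -
  note bl = bilinear_form[of S]
  have "\<exists>e. \<forall>i\<in>I. \<forall>j\<in>I. form S (e i) (e j) = (if i = j then 1 else 0)" for I :: "'m set"
  proof (induction I rule: finite_induct[OF finite])
    case 1
    show ?case by simp
  next
    case (2 k I)
    then obtain e where e: "\<And>i j. i \<in> I \<Longrightarrow> j \<in> I \<Longrightarrow> form S (e i) (e j) = (if i = j then 1 else 0)"
      by blast
    \<comment> \<open>The index \<open>k\<close> is missing from \<open>I\<close>, so the vectors
      found so far are too few to span and some \<open>v\<close> lies outside.\<close>
    have "card I < CARD('m)"
      using 2(2) by (intro psubset_card_mono) auto
    then have "dim (e ` I) < CARD('m)"
      by (meson card_image_le dim_le_card' finite finite_imageI le_less_trans order_trans)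
    then have "span (e ` I) \<noteq> UNIV"
      by (metis dim_UNIV dim_span less_irrefl DIM_cart DIM_real mult.right_neutral)
    then obtain v where v: "v \<notin> span (e ` I)" by auto
    define w where "w = v - (\<Sum>i\<in>I. form S (e i) v *\<^sub>R e i)"
    have "(\<Sum>i\<in>I. form S (e i) v *\<^sub>R e i) \<in> span (e ` I)"
      by (intro span_sum span_scale span_base imageI)
    then have "w \<noteq> 0" using v by (auto simp: w_def)
    then have pos: "form S w w > 0" using assms by (simp add: spd_def)
    have orth: "form S (e j) w = 0" if "j \<in> I" for j
    proof -
      have "form S (e j) w = form S (e j) v - (\<Sum>i\<in>I. form S (e i) v * form S (e j) (e i))"
        unfolding w_def
        by (simp add: bilinear_rsub[OF bl] linear_sum[OF bilinear_def[THEN iffD1, OF bl, THEN conjunct1, rule_format]] bilinear_rmul[OF bl])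
      also have "(\<Sum>i\<in>I. form S (e i) v * form S (e j) (e i)) = (\<Sum>i\<in>I. if i = j then form S (e i) v else 0)"
        using that by (intro sum.cong) (auto simp: e)
      finally show ?thesis using that by simp
    qed
    have orth': "form S w (e j) = 0" if "j \<in> I" for j
      using orth[OF that] form_commute[of S w "e j"] assms by (simp add: spd_def)
    let ?w = "(1 / sqrt (form S w w)) *\<^sub>R w"
    have "form S ?w ?w = 1"
      using pos by (simp add: bilinear_lmul[OF bl] bilinear_rmul[OF bl] field_simps)
    moreover have "form S ?w (e j) = 0" "form S (e j) ?w = 0" if "j \<in> I" for j
      using orth[OF that] orth'[OF that] by (simp_all add: bilinear_lmul[OF bl] bilinear_rmul[OF bl])
    ultimately have "\<forall>i\<in>insert k I. \<forall>j\<in>insert k I.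
        form S ((e(k := ?w)) i) ((e(k := ?w)) j) = (if i = j then 1 else 0)"
      using 2(2) e by auto
    then show ?case by blast
  qed
  from this[of UNIV] show ?thesis by (auto simp: orthonormal_basis_def)
qed

text \<open>Let \<open>E\<close> have the frame vectors as columns. Orthonormality says that
  \<open>transpose E ** S ** E\<close> is the identity, hence \<open>E ** transpose E\<close>
  inverts \<open>S\<close>; the claim is column \<open>a\<close> of this equation.\<close>

lemma sum_frame:
  fixes S :: "real^'m^'m"
  assumes "spd S"
  shows "(\<Sum>i\<in>UNIV. frame S i $ a *\<^sub>R frame S i) = matrix_inv S *v axis a 1"
proof -
  have e: "orthonormal_basis S (frame S)"
    unfolding frame_def using orthonormal_basis_exists[OF assms] by (rule someI_ex)
  define E where "E = (\<chi> a i. frame S i $ a)"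
  have "(transpose E ** S ** E) $ i $ j = form S (frame S i) (frame S j)" for i j
    unfolding form_eq_sum E_def
    by (simp add: matrix_matrix_mult_def transpose_def sum_distrib_right)
       (subst sum.swap, simp add: mult_ac)
  then have "transpose E ** S ** E = mat 1"
    using e by (auto simp: orthonormal_basis_def vec_eq_iff mat_def)
  then have "E ** transpose E ** S = mat 1"
    by (simp add: matrix_left_right_inverse[of E] matrix_mul_assoc[symmetric])
  then have "S ** (E ** transpose E) = mat 1"
    by (simp add: matrix_left_right_inverse[of S])
  then have "matrix_inv S = E ** transpose E" by (rule matrix_inv_eqI)
  then show ?thesis
    by (simp add: vec_eq_iff matrix_vector_mult_basis column_def matrix_matrix_mult_def E_def
        transpose_def mult.commute)
qed

text \<open>Expanding the first argument in the standard basis reduces the trace to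
  \<open>sum_frame\<close>. This removes the unspecified frame from the tension, the energy density
  and the divergence.\<close>

lemma trace_frame:
  fixes S :: "real^'m^'m" and \<beta> :: "real^'m \<Rightarrow> real^'m \<Rightarrow> 'v::real_vector"
  assumes "spd S" "bilinear \<beta>"
  shows "(\<Sum>i\<in>UNIV. \<beta> (frame S i) (frame S i)) = (\<Sum>a\<in>UNIV. \<beta> (axis a 1) (matrix_inv S *v axis a 1))"
proof -
  have lin: "linear (\<beta> u)" "linear (\<lambda>u. \<beta> u v)" for u v using assms(2) by (auto simp: bilinear_def)
  have expand: "\<beta> u v = (\<Sum>a\<in>UNIV. u $ a *\<^sub>R \<beta> (axis a 1) v)" for u v
  proof -
    have "\<beta> u v = \<beta> (\<Sum>a\<in>UNIV. u $ a *\<^sub>R axis a 1) v"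
      by (simp add: basis_expansion[of u, unfolded scalar_mult_eq_scaleR])
    also have "\<dots> = (\<Sum>a\<in>UNIV. u $ a *\<^sub>R \<beta> (axis a 1) v)"
      by (simp add: linear_sum[OF lin(2)] linear_cmul[OF lin(2)])
    finally show ?thesis .
  qed
  have "\<beta> v v = (\<Sum>a\<in>UNIV. \<beta> (axis a 1) (v $ a *\<^sub>R v))" for v
    by (subst expand) (simp add: linear_cmul[OF lin(1)])
  then have "(\<Sum>i\<in>UNIV. \<beta> (frame S i) (frame S i))
      = (\<Sum>i\<in>UNIV. \<Sum>a\<in>UNIV. \<beta> (axis a 1) (frame S i $ a *\<^sub>R frame S i))"
    by (rule sum.cong[OF refl])
  also have "\<dots> = (\<Sum>a\<in>UNIV. \<beta> (axis a 1) (\<Sum>i\<in>UNIV. frame S i $ a *\<^sub>R frame S i))"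
    by (subst sum.swap) (simp add: linear_sum[OF lin(1)])
  finally show ?thesis by (simp add: sum_frame[OF assms(1)])
qed

section \<open>Covariant derivatives in terms of connection matrices\<close>

definition christoffel_matrix :: "(real^'m::finite \<Rightarrow> real^'m^'m) \<Rightarrow> real^'m \<Rightarrow> 'm \<Rightarrow> real^'m^'m" where
  "christoffel_matrix G x a = (\<chi> k j. christoffel_symbol G x k a j)"

text \<open>In a coordinate direction the connection acts as a matrix, so that covariant derivatives
  become matrix products.\<close>

lemma christoffel_axis: "christoffel G x (axis a 1) v = christoffel_matrix G x a *v v"
  by (simp add: christoffel_def christoffel_matrix_def matrix_vector_mult_def vec_eq_iff axis_def
      if_distrib if_distribR cong: if_cong) (subst sum.swap, simp)

lemma bilinear_christoffel: "bilinear (christoffel G x)"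
  unfolding bilinear_def christoffel_def
  by (auto intro!: linearI simp: vec_eq_iff algebra_simps sum.distrib sum_distrib_left)

lemma partial_eq: "(k has_derivative D) (at x) \<Longrightarrow> partial i k x = D (axis i 1)"
  unfolding partial_def by (metis frechet_derivative_at)

lemma partial_entry_eq:
  "(G has_derivative D) (at x) \<Longrightarrow> partial i (\<lambda>y. G y $ j $ l) x = D (axis i 1) $ j $ l"
  by (rule partial_eq[OF bounded_linear.has_derivative[OF bounded_linear_entry]])

text \<open>As \<open>v\<close> is constant, the derivative falls on the Jacobian alone; the second
  derivative of the map is kept as the linear map \<open>DJ\<close>.\<close>

lemma nabla_d_eq:
  assumes "((\<lambda>y. jacobian f (at y)) has_derivative DJ) (at x)"
  shows "nabla_d G H f x u v = DJ u *v v
    + christoffel H (f x) (jacobian f (at x) *v u) (jacobian f (at x) *v v)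
    - jacobian f (at x) *v christoffel G x u v"
proof -
  have "((\<lambda>y. jacobian f (at y) *v v) has_derivative (\<lambda>u. DJ u *v v)) (at x)"
    using has_derivative_matrix_vector_mult[OF assms has_derivative_const[of v]]
    by (simp add: bounded_bilinear.zero_right[OF bounded_bilinear_matrix_vector_mult])
  then have "frechet_derivative (\<lambda>y. jacobian f (at y) *v v) (at x) = (\<lambda>u. DJ u *v v)"
    by (rule frechet_derivative_at[symmetric])
  then show ?thesis by (simp add: nabla_d_def cov_deriv_along_def cov_deriv_def)
qed

text \<open>Makes \<open>trace_frame\<close> applicable to the two traces of \<open>nabla_d\<close>
  in the tension field.\<close>

lemma bilinear_nabla_d:
  assumes "((\<lambda>y. jacobian f (at y)) has_derivative DJ) (at x)"
  shows "bilinear (nabla_d G H f x)"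
proof -
  have lD: "linear DJ" using assms by (rule has_derivative_linear)
  show ?thesis
    unfolding bilinear_def
    by (auto intro!: linearI simp: nabla_d_eq[OF assms] matrix_vector_mult_linear_simps
        linear_add[OF lD] linear_cmul[OF lD] bilinear_ladd[OF bilinear_christoffel] bilinear_radd[OF bilinear_christoffel]
        bilinear_lmul[OF bilinear_christoffel] bilinear_rmul[OF bilinear_christoffel] scaleR_add_right scaleR_diff_right)
qed

lemma nabla_endo_eq:
  assumes "(C has_derivative DC) (at x)"
  shows "nabla_endo G C x u v = DC u *v v + christoffel G x u (C x *v v) - C x *v christoffel G x u v"
proof -
  have "((\<lambda>y. C y *v v) has_derivative (\<lambda>u. DC u *v v)) (at x)"
    using has_derivative_matrix_vector_mult[OF assms has_derivative_const[of v]]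
    by (simp add: bounded_bilinear.zero_right[OF bounded_bilinear_matrix_vector_mult])
  then have "frechet_derivative (\<lambda>y. C y *v v) (at x) = (\<lambda>u. DC u *v v)"
    by (rule frechet_derivative_at[symmetric])
  then show ?thesis by (simp add: nabla_endo_def cov_deriv_def)
qed

lemma bilinear_nabla_endo:
  assumes "(C has_derivative DC) (at x)"
  shows "bilinear (nabla_endo G C x)"
proof -
  have lD: "linear DC" using assms by (rule has_derivative_linear)
  show ?thesis
    unfolding bilinear_def
    by (auto intro!: linearI simp: nabla_endo_eq[OF assms] matrix_vector_mult_linear_simps
        linear_add[OF lD] linear_cmul[OF lD] bilinear_ladd[OF bilinear_christoffel] bilinear_radd[OF bilinear_christoffel]
        bilinear_lmul[OF bilinear_christoffel] bilinear_rmul[OF bilinear_christoffel] scaleR_add_right scaleR_diff_right)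
qed

text \<open>The pull-back of \<open>H\<close> has Gram matrix \<open>M\<close>. By
  \<open>trace_frame\<close> its trace with respect to \<open>G\<close> is that of
  \<open>M ** matrix_inv (G y)\<close>, and cyclicity turns this product into the Cauchy-Green
  tensor.\<close>

lemma energy_density_eq_trace:
  assumes "spd (G y)"
  shows "energy_density G H f y = trace (cauchy_green G H f y) / 2"
proof -
  define J where "J = jacobian f (at y)"
  define M where "M = transpose J ** H (f y) ** J"
  have form: "form (H (f y)) (J *v u) (J *v v) = form M u v" for u v
    using dot_lmul_matrix[of u "transpose J" "H (f y) *v (J *v v)"]
    by (simp add: form_def M_def matrix_vector_mul_assoc[symmetric] del: transpose_matrix_vector)
  have "energy_density G H f y = (\<Sum>a\<in>UNIV. form M (axis a 1) (matrix_inv (G y) *v axis a 1)) / 2"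
    unfolding energy_density_def J_def[symmetric] form
    by (simp add: trace_frame[OF assms bilinear_form])
  also have "(\<Sum>a\<in>UNIV. form M (axis a 1) (matrix_inv (G y) *v axis a 1)) = trace (M ** matrix_inv (G y))"
    by (simp add: trace_def form_def inner_axis' matrix_vector_mul_assoc)
       (simp add: matrix_vector_mult_basis column_def)
  also have "\<dots> = trace (cauchy_green G H f y)"
    unfolding cauchy_green_def d_adjoint_def M_def J_def
    by (subst trace_mul_sym) (simp add: matrix_mul_assoc)
  finally show ?thesis .
qed

lemma symmetric_matrix_entry:
  assumes "transpose A = A"
  shows "A $ i $ j = A $ j $ i"
  using arg_cong[OF assms, of "\<lambda>A. A $ j $ i"] by (simp add: transpose_def)

section \<open>The Levi-Civita connection at a point\<close>

context
  fixes G :: "real^'m \<Rightarrow> real^'m^'m" and D :: "real^'m \<Rightarrow> real^'m^'m" and x :: "real^'m"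
  assumes spd: "\<forall>\<^sub>F y in nhds x. spd (G y)"
    and G': "(G has_derivative D) (at x)"
begin

lemma metric_at:
  shows "spd (G x)" "invertible (G x)" "transpose (G x) = G x"
    "transpose (matrix_inv (G x)) = matrix_inv (G x)"
proof -
  show spd_x: "spd (G x)" using spd by (rule eventually_nhds_x_imp_x)
  then show "invertible (G x)" "transpose (G x) = G x"
    by (simp_all add: spd_invertible) (simp add: spd_def)
  then show "transpose (matrix_inv (G x)) = matrix_inv (G x)" by (rule transpose_matrix_inv)
qed

lemma transpose_metric_derivative: "transpose (D u) = D u"
proof -
  have "((\<lambda>y. transpose (G y)) has_derivative (\<lambda>u. transpose (D u))) (at x)"
    by (rule bounded_linear.has_derivative[OF bounded_linear_transpose G'])
  then have "(G has_derivative (\<lambda>u. transpose (D u))) (at x)"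
    by (rule has_derivative_transform_nhds)
       (use spd in \<open>rule eventually_mono\<close>, simp add: spd_def)
  from has_derivative_unique[OF this G'] show ?thesis by metis
qed

lemma metric_derivative_sym: "D u $ i $ j = D u $ j $ i"
  by (rule symmetric_matrix_entry[OF transpose_metric_derivative])

text \<open>Christoffel symbols of the first kind.\<close>

definition "lowered a = (\<chi> k j. (D (axis a 1) $ j $ k + D (axis j 1) $ a $ k - D (axis k 1) $ a $ j) / 2)"

lemma christoffel_matrix_eq: "christoffel_matrix G x a = matrix_inv (G x) ** lowered a"
  by (simp add: christoffel_matrix_def christoffel_symbol_def lowered_def matrix_matrix_mult_def
      partial_entry_eq[OF G'] sum_divide_distrib)

text \<open>Compatibility of the connection with the metric: the last two terms of
  \<open>lowered a\<close> are antisymmetric in \<open>k\<close> and \<open>j\<close> and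
  cancel.\<close>

lemma lowered_add_transpose: "lowered a + transpose (lowered a) = D (axis a 1)"
  by (simp add: lowered_def transpose_def vec_eq_iff metric_derivative_sym field_simps)

lemma has_derivative_inverse_metric:
  "((\<lambda>y. matrix_inv (G y)) has_derivative (\<lambda>h. - (matrix_inv (G x) ** D h ** matrix_inv (G x)))) (at x)"
  by (rule has_derivative_matrix_inv[OF G' metric_at(2)])

text \<open>With \<open>has_derivative_inverse_metric\<close>, this says that the inverse metric is parallel.\<close>

lemma inverse_metric_derivative:
  "matrix_inv (G x) ** D (axis a 1) ** matrix_inv (G x) =
   christoffel_matrix G x a ** matrix_inv (G x) + matrix_inv (G x) ** transpose (christoffel_matrix G x a)"
  by (simp add: lowered_add_transpose[symmetric, of a] christoffel_matrix_eq matrix_mult_linear_simps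
      matrix_transpose_mul metric_at matrix_mul_assoc)

text \<open>The vector on the right is the differential of \<open>ln \<surd>(det G)\<close>.\<close>

lemma christoffel_trace:
  "(\<Sum>a\<in>UNIV. transpose (christoffel_matrix G x a) *v axis a 1) =
   (\<chi> k. trace (matrix_inv (G x) ** D (axis k 1)) / 2)"
proof -
  define P where "P = matrix_inv (G x)"
  have P: "P $ i $ j = P $ j $ i" for i j
    unfolding P_def by (rule symmetric_matrix_entry[OF metric_at(4)])
  have "(\<Sum>a\<in>UNIV. \<Sum>l\<in>UNIV. P $ a $ l * (D (axis a 1) $ k $ l + D (axis k 1) $ a $ l - D (axis l 1) $ a $ k)) =
      (\<Sum>a\<in>UNIV. \<Sum>l\<in>UNIV. P $ a $ l * D (axis k 1) $ l $ a)" for k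
  proof -
    \<comment> \<open>Exchanging the two indices identifies the first term with the third, by
      symmetry of \<open>P\<close> and \<open>D\<close>. They cancel, and only the derivative in
      direction \<open>k\<close> survives.\<close>
    have "(\<Sum>a\<in>UNIV. \<Sum>l\<in>UNIV. P $ a $ l * D (axis a 1) $ k $ l) =
        (\<Sum>l\<in>UNIV. \<Sum>a\<in>UNIV. P $ a $ l * D (axis a 1) $ k $ l)"
      by (rule sum.swap)
    also have "\<dots> = (\<Sum>l\<in>UNIV. \<Sum>a\<in>UNIV. P $ l $ a * D (axis a 1) $ l $ k)"
      by (intro sum.cong refl arg_cong2[where f = "(*)"] P metric_derivative_sym)
    finally have "(\<Sum>a\<in>UNIV. \<Sum>l\<in>UNIV. P $ a $ l * D (axis a 1) $ k $ l) =
        (\<Sum>a\<in>UNIV. \<Sum>l\<in>UNIV. P $ a $ l * D (axis l 1) $ a $ k)" .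
    moreover have "(\<Sum>a\<in>UNIV. \<Sum>l\<in>UNIV. P $ a $ l * D (axis k 1) $ a $ l) =
        (\<Sum>a\<in>UNIV. \<Sum>l\<in>UNIV. P $ a $ l * D (axis k 1) $ l $ a)"
      by (intro sum.cong refl arg_cong2[where f = "(*)"] metric_derivative_sym)
    ultimately show ?thesis
      by (simp add: algebra_simps sum.distrib sum_subtractf)
  qed
  note eq = this
  have "(\<Sum>a\<in>UNIV. transpose (christoffel_matrix G x a) *v axis a 1) $ k =
      (\<Sum>a\<in>UNIV. \<Sum>l\<in>UNIV. P $ a $ l * (D (axis a 1) $ k $ l + D (axis k 1) $ a $ l - D (axis l 1) $ a $ k)) / 2" for k
    unfolding christoffel_matrix_eq P_def[symmetric]
    by (simp add: matrix_vector_mult_basis column_def transpose_def lowered_def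
        matrix_matrix_mult_def sum_divide_distrib del: transpose_matrix_vector)
  then show ?thesis
    unfolding eq by (simp add: vec_eq_iff trace_def matrix_matrix_mult_def P_def)
qed

text \<open>The inverse metric is parallel, so an index of \<open>C\<close> may be raised before
  taking the divergence. The right-hand side is the coordinate divergence of the contravariant
  tensor \<open>C P\<close>: a partial derivative and one Christoffel term for each index.\<close>

lemma divergence_endo_eq:
  assumes C': "(C has_derivative DC) (at x)"
    and T': "((\<lambda>y. C y ** matrix_inv (G y)) has_derivative DT) (at x)"
  shows "divergence_endo G C x =
    (\<Sum>a\<in>UNIV. (DT (axis a 1) + christoffel_matrix G x a ** (C x ** matrix_inv (G x))
       + C x ** matrix_inv (G x) ** transpose (christoffel_matrix G x a)) *v axis a 1)"
proof -
  let ?P = "matrix_inv (G x)" and ?\<Gamma> = "christoffel_matrix G x"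
  have DT: "DT (axis a 1) = DC (axis a 1) ** ?P
      - C x ** (?\<Gamma> a ** ?P + ?P ** transpose (?\<Gamma> a))" for a
    using has_derivative_unique[OF T' has_derivative_matrix_mult[OF C' has_derivative_inverse_metric]]
    by (simp add: inverse_metric_derivative matrix_mult_linear_simps)
  have "divergence_endo G C x = (\<Sum>a\<in>UNIV. nabla_endo G C x (axis a 1) (?P *v axis a 1))"
    unfolding divergence_endo_def by (rule trace_frame[OF metric_at(1) bilinear_nabla_endo[OF C']])
  also have "\<dots> = (\<Sum>a\<in>UNIV. (DT (axis a 1) + ?\<Gamma> a ** (C x ** ?P) + C x ** ?P ** transpose (?\<Gamma> a)) *v axis a 1)"
    by (intro sum.cong refl)
      (simp add: nabla_endo_eq[OF C'] christoffel_axis DT matrix_vector_mul_assoc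
        matrix_mul_assoc matrix_mult_linear_simps matrix_vector_mult_linear_simps[symmetric] add_diff_eq)
  finally show ?thesis .
qed

text \<open>Brings the gradient into the shape of \<open>divergence_endo_eq\<close>: it is the
  divergence of \<open>k P\<close>, since \<open>P\<close> is parallel.\<close>

lemma gradient_eq:
  assumes "(k has_derivative Dk) (at x)"
  shows "gradient G k x = (\<Sum>a\<in>UNIV. Dk (axis a 1) *\<^sub>R (matrix_inv (G x) *v axis a 1))"
proof -
  have "(\<chi> i. partial i k x) = (\<Sum>a\<in>UNIV. Dk (axis a 1) *\<^sub>R axis a 1)"
    using basis_expansion[of "\<chi> i. Dk (axis i 1)"] by (simp add: partial_eq[OF assms] scalar_mult_eq_scaleR)
  then show ?thesis
    unfolding gradient_def
    by (simp add: linear_sum[OF matrix_vector_mul_linear] matrix_vector_mult_linear_simps)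
qed

end

section \<open>The stress tensor and the divergence formula\<close>

definition sigma2_stress ::
  "(real^'m::finite \<Rightarrow> real^'m^'m) \<Rightarrow> (real^'n::finite \<Rightarrow> real^'n^'n) \<Rightarrow> (real^'m \<Rightarrow> real^'n)
    \<Rightarrow> real^'m \<Rightarrow> real^'m^'m" where
  "sigma2_stress G H f x = (2 * energy_density G H f x) *\<^sub>R matrix_inv (G x)
     - cauchy_green G H f x ** matrix_inv (G x)"

lemma
  fixes G :: "real^'m \<Rightarrow> real^'m^'m" and H :: "real^'n \<Rightarrow> real^'n^'n" and f :: "real^'m \<Rightarrow> real^'n"
  assumes spd: "\<forall>\<^sub>F y in nhds x. spd (G y)" and G': "G differentiable (at x)"
    and J': "(\<lambda>y. jacobian f (at y)) differentiable (at x)"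
    and H': "(\<lambda>y. H (f y)) differentiable (at x)"
  shows differentiable_cauchy_green: "cauchy_green G H f differentiable (at x)"
    and differentiable_energy_density: "energy_density G H f differentiable (at x)"
    and differentiable_sigma2_stress: "sigma2_stress G H f differentiable (at x)"
proof -
  have P': "(\<lambda>y. matrix_inv (G y)) differentiable (at x)"
    using G' spd_invertible[OF eventually_nhds_x_imp_x[OF spd]] by (rule differentiable_matrix_inv)
  show C': "cauchy_green G H f differentiable (at x)"
    unfolding cauchy_green_def[abs_def] d_adjoint_def
    by (intro differentiable_matrix_mult differentiable_transpose P' J' H')
  \<comment> \<open>The frames chosen at different points need not vary differentiably, so
    regularity of the energy density is read off from its trace formula.\<close>
  have "(\<lambda>y. trace (cauchy_green G H f y) / 2) differentiable (at x)"
    by (intro differentiable_divide differentiable_trace C' differentiable_const) simp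
  then show e': "energy_density G H f differentiable (at x)"
    by (rule differentiable_transform_nhds)
       (use spd in \<open>rule eventually_mono\<close>, simp add: energy_density_eq_trace)
  show "sigma2_stress G H f differentiable (at x)"
    unfolding sigma2_stress_def[abs_def]
    by (intro differentiable_diff differentiable_scaleR differentiable_mult differentiable_const
        differentiable_matrix_mult C' e' P')
qed

text \<open>The product rule for \<open>W = J S\<close>. The tension field is the trace of
  \<open>nabla_d\<close> against \<open>S\<close> plus \<open>J\<close> applied to the divergence of
  \<open>S\<close>. The domain Christoffel term of \<open>nabla_d\<close> cancels one of the two in
  the divergence, and the other contracts to the differential of the logarithmic volume
  density.\<close>

lemma sigma2_tension_eq_divergence:
  fixes G :: "real^'m \<Rightarrow> real^'m^'m" and H :: "real^'n \<Rightarrow> real^'n^'n" and f :: "real^'m \<Rightarrow> real^'n"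
  assumes spd: "\<forall>\<^sub>F y in nhds x. spd (G y)" and G': "(G has_derivative D) (at x)"
    and J': "(\<lambda>y. jacobian f (at y)) differentiable (at x)"
    and H': "(\<lambda>y. H (f y)) differentiable (at x)"
    and W': "((\<lambda>y. jacobian f (at y) ** sigma2_stress G H f y) has_derivative DW) (at x)"
  defines "J \<equiv> jacobian f (at x)" and "W \<equiv> jacobian f (at x) ** sigma2_stress G H f x"
  shows "sigma2_tension G H f x =
    (\<Sum>a\<in>UNIV. DW (axis a 1) *v axis a 1 + christoffel H (f x) (J *v axis a 1) (W *v axis a 1))
    + W *v (\<chi> k. trace (matrix_inv (G x) ** D (axis k 1)) / 2)"
proof -
  let ?P = "matrix_inv (G x)" and ?\<Gamma> = "christoffel_matrix G x" and ?e = "energy_density G H f x"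
    and ?C = "cauchy_green G H f x" and ?S = "sigma2_stress G H f x"
  note diff = spd differentiableI[OF G'] J' H'
  obtain DJ where DJ: "((\<lambda>y. jacobian f (at y)) has_derivative DJ) (at x)"
    using J' unfolding differentiable_def by blast
  obtain DC where DC: "(cauchy_green G H f has_derivative DC) (at x)"
    using differentiable_cauchy_green[OF diff] unfolding differentiable_def by blast
  obtain De where De: "(energy_density G H f has_derivative De) (at x)"
    using differentiable_energy_density[OF diff] unfolding differentiable_def by blast
  obtain DS where DS: "(sigma2_stress G H f has_derivative DS) (at x)"
    using differentiable_sigma2_stress[OF diff] unfolding differentiable_def by blast
  note DP = has_derivative_inverse_metric[OF spd G']
  define DT where "DT h = ?C ** - (?P ** D h ** ?P) + DC h ** ?P" for h
  have DT: "((\<lambda>y. cauchy_green G H f y ** matrix_inv (G y)) has_derivative DT) (at x)"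
    unfolding DT_def by (rule has_derivative_matrix_mult[OF DC DP])
  have "(sigma2_stress G H f has_derivative
      (\<lambda>h. (2 * ?e) *\<^sub>R - (?P ** D h ** ?P) + (2 * De h) *\<^sub>R ?P - DT h)) (at x)"
    unfolding sigma2_stress_def[abs_def]
    by (intro has_derivative_diff has_derivative_scaleR DT DP has_derivative_mult_right De)
  from has_derivative_unique[OF DS this] have DS_eq: "DS (axis a 1) =
      (2 * De (axis a 1)) *\<^sub>R ?P - (2 * ?e) *\<^sub>R (?\<Gamma> a ** ?P + ?P ** transpose (?\<Gamma> a)) - DT (axis a 1)" for a
    by (simp add: inverse_metric_derivative[OF spd G'])
  have DW_eq: "DW h = J ** DS h + DJ h ** ?S" for h
    using has_derivative_unique[OF W' has_derivative_matrix_mult[OF DJ DS]] by (simp add: J_def)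
  note nabla = bilinear_nabla_d[OF DJ, of G H]
  have linC: "linear (\<lambda>v. ?C *v v)" by simp
  have tension: "tension G H f x = (\<Sum>a\<in>UNIV. nabla_d G H f x (axis a 1) (?P *v axis a 1))"
    unfolding tension_def by (rule trace_frame[OF eventually_nhds_x_imp_x[OF spd] nabla])
  have "bilinear (\<lambda>u v. nabla_d G H f x u (?C *v v))"
    using nabla unfolding bilinear_def
    by (auto intro: linear_compose[OF linC, unfolded o_def])
  then have traceC: "(\<Sum>i\<in>UNIV. nabla_d G H f x (frame (G x) i) (?C *v frame (G x) i)) =
      (\<Sum>a\<in>UNIV. nabla_d G H f x (axis a 1) (?C ** ?P *v axis a 1))"
    by (subst trace_frame[OF eventually_nhds_x_imp_x[OF spd], where \<beta> = "\<lambda>u v. nabla_d G H f x u (?C *v v)"])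
       (simp_all add: matrix_vector_mul_assoc)
  have S: "?S *v v = (2 * ?e) *\<^sub>R (?P *v v) - ?C ** ?P *v v" for v
    by (simp add: sigma2_stress_def matrix_vector_mult_linear_simps)
  \<comment> \<open>The two traces of \<open>nabla_d\<close> combine into one against
    \<open>S\<close>, because \<open>S\<close> is exactly \<open>2 e P - C P\<close>.\<close>
  have "sigma2_tension G H f x =
      (\<Sum>a\<in>UNIV. nabla_d G H f x (axis a 1) (?S *v axis a 1))
      + J *v (2 *\<^sub>R gradient G (energy_density G H f) x - divergence_endo G (cauchy_green G H f) x)"
    unfolding sigma2_tension_def tension traceC S J_def
    by (simp add: bilinear_rsub[OF nabla] bilinear_rmul[OF nabla] matrix_vector_mult_linear_simps
        sum_subtractf scaleR_sum_right scaleR_add_right)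
  \<comment> \<open>The divergence of \<open>S\<close>: the derivative of \<open>P\<close> inside
    \<open>2 e P\<close> is compensated by the Christoffel terms of that summand.\<close>
  also have "2 *\<^sub>R gradient G (energy_density G H f) x - divergence_endo G (cauchy_green G H f) x =
      (\<Sum>a\<in>UNIV. (DS (axis a 1) + ?\<Gamma> a ** ?S + ?S ** transpose (?\<Gamma> a)) *v axis a 1)"
    unfolding gradient_eq[OF spd G' De] divergence_endo_eq[OF spd G' DC DT] scaleR_sum_right
      sum_subtractf[symmetric]
    by (intro sum.cong refl)
      (simp add: DS_eq sigma2_stress_def matrix_vector_mult_linear_simps matrix_mult_linear_simps
        matrix_mul_assoc algebra_simps)
  also have "J *v \<dots> = (\<Sum>a\<in>UNIV. J *v ((DS (axis a 1) + ?\<Gamma> a ** ?S) *v axis a 1))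
      + W *v (\<Sum>a\<in>UNIV. transpose (?\<Gamma> a) *v axis a 1)"
    by (simp add: linear_sum[OF matrix_vector_mul_linear] W_def J_def matrix_vector_mul_assoc
        matrix_mul_assoc matrix_vector_mult_linear_simps matrix_mult_linear_simps sum.distrib del: transpose_matrix_vector)
  \<comment> \<open>Here \<open>J ** ?\<Gamma> a ** ?S\<close> cancels, and
    \<open>J ** DS h + DJ h ** ?S\<close> becomes \<open>DW h\<close>.\<close>
  also have "(\<Sum>a\<in>UNIV. nabla_d G H f x (axis a 1) (?S *v axis a 1)) + \<dots> =
      (\<Sum>a\<in>UNIV. DW (axis a 1) *v axis a 1 + christoffel H (f x) (J *v axis a 1) (W *v axis a 1))
      + W *v (\<Sum>a\<in>UNIV. transpose (?\<Gamma> a) *v axis a 1)"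
    unfolding add.assoc[symmetric] sum.distrib[symmetric]
    by (rule arg_cong2[OF sum.cong[OF refl] refl])
      (simp add: nabla_d_eq[OF DJ] christoffel_axis DW_eq W_def J_def matrix_vector_mul_assoc matrix_mul_assoc
        matrix_vector_mult_linear_simps matrix_mult_linear_simps)
  finally show ?thesis unfolding christoffel_trace[OF spd G'] .
qed

section \<open>Change of metric\<close>

lemma trace_scaleR: "trace (c *\<^sub>R A) = c * trace (A :: real^'n^'n)"
  by (simp add: trace_def sum_distrib_left)

lemma transpose_linear_simps:
  fixes A B :: "real^'n^'m"
  shows "transpose (A + B) = transpose A + transpose B"
    "transpose (A - B) = transpose A - transpose B"
    "transpose (c *\<^sub>R A) = c *\<^sub>R transpose A"
  by (simp_all add: transpose_def vec_eq_iff)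

text \<open>Both inverse metrics are symmetric, so transposing the hypothesis moves the factor to
  the left part of the adjoint of the differential.\<close>

lemma cauchy_green_change:
  assumes "spd (G y)" "spd (G' y)"
    and J: "jacobian f (at y) ** matrix_inv (G' y) = s *\<^sub>R (jacobian f (at y) ** matrix_inv (G y))"
  shows "cauchy_green G' H f y = s *\<^sub>R cauchy_green G H f y"
proof -
  have sym: "transpose (matrix_inv (G y)) = matrix_inv (G y)" "transpose (matrix_inv (G' y)) = matrix_inv (G' y)"
    using assms(1,2) by (simp_all add: transpose_matrix_inv spd_invertible spd_def)
  have "matrix_inv (G' y) ** transpose (jacobian f (at y)) =
      s *\<^sub>R (matrix_inv (G y) ** transpose (jacobian f (at y)))"
    using arg_cong[OF J, of transpose] by (simp add: matrix_transpose_mul sym transpose_linear_simps)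
  then show ?thesis
    by (simp add: cauchy_green_def d_adjoint_def matrix_mult_linear_simps)
qed

text \<open>One factor \<open>s\<close> comes from the energy density or the Cauchy-Green tensor.
  The other comes from the inverse metric on the right, which is preceded by \<open>J\<close> in
  both summands, as \<open>J\<close> is also the last factor of the Cauchy-Green tensor.\<close>

lemma sigma2_stress_change:
  assumes "spd (G y)" "spd (G' y)"
    and J: "jacobian f (at y) ** matrix_inv (G' y) = s *\<^sub>R (jacobian f (at y) ** matrix_inv (G y))"
  shows "jacobian f (at y) ** sigma2_stress G' H f y = s\<^sup>2 *\<^sub>R (jacobian f (at y) ** sigma2_stress G H f y)"
proof -
  note cg = cauchy_green_change[where G = G and G' = G' and H = H, OF assms]
  have e: "energy_density G' H f y = s * energy_density G H f y"
    using assms(1,2) by (simp add: energy_density_eq_trace cg trace_scaleR)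
  have "cauchy_green G H f y = d_adjoint G H f y ** jacobian f (at y)"
    by (simp add: cauchy_green_def)
  then have "cauchy_green G H f y ** matrix_inv (G' y) = s *\<^sub>R (cauchy_green G H f y ** matrix_inv (G y))"
    using J by (simp add: matrix_mul_assoc[symmetric] matrix_mult_linear_simps)
  then show ?thesis
    using J by (simp add: sigma2_stress_def matrix_mult_linear_simps cg e power2_eq_square scaleR_diff_right mult_ac)
qed

text \<open>Compare the divergence formulas of the two metrics. As \<open>W\<close> is multiplied by
  the square of \<open>s\<close>, the product rule adds a multiple of \<open>Ds\<close>, while the
  volume density adds \<open>Du\<close>. Once the square of \<open>s\<close> is factored out, both
  are \<open>W\<close> applied to the differential of \<open>w\<close>.\<close>

lemma sigma2_tension_change:
  fixes G G' :: "real^'m \<Rightarrow> real^'m^'m" and H :: "real^'n \<Rightarrow> real^'n^'n" and f :: "real^'m \<Rightarrow> real^'n"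
  assumes spd: "\<forall>\<^sub>F y in nhds x. spd (G y)" and D: "(G has_derivative D) (at x)"
    and spd': "\<forall>\<^sub>F y in nhds x. spd (G' y)" and D': "(G' has_derivative D') (at x)"
    and J': "(\<lambda>y. jacobian f (at y)) differentiable (at x)"
    and H': "(\<lambda>y. H (f y)) differentiable (at x)"
    and s: "\<forall>\<^sub>F y in nhds x. jacobian f (at y) ** matrix_inv (G' y) =
              s y *\<^sub>R (jacobian f (at y) ** matrix_inv (G y))"
    and Ds: "(s has_derivative Ds) (at x)" "s x \<noteq> 0"
    and vol: "\<And>k. trace (matrix_inv (G' x) ** D' (axis k 1)) / 2 =
              trace (matrix_inv (G x) ** D (axis k 1)) / 2 + Du (axis k 1)"
    and w: "(w has_derivative (\<lambda>h. 2 * Ds h / s x + Du h)) (at x)"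
  shows "sigma2_tension G' H f x = (s x)\<^sup>2 *\<^sub>R (sigma2_tension G H f x
      + (2 * energy_density G H f x) *\<^sub>R (jacobian f (at x) *v gradient G w x)
      - jacobian f (at x) *v weighted_gradient G H f w x)"
proof -
  define W where "W y = jacobian f (at y) ** sigma2_stress G H f y" for y
  have "W differentiable (at x)"
    unfolding W_def[abs_def]
    by (intro differentiable_matrix_mult J' differentiable_sigma2_stress spd differentiableI[OF D] H')
  then obtain DW where DW: "(W has_derivative DW) (at x)"
    unfolding differentiable_def by blast
  have W': "\<forall>\<^sub>F y in nhds x. (s y)\<^sup>2 *\<^sub>R W y = jacobian f (at y) ** sigma2_stress G' H f y"
    using spd spd' s unfolding W_def by eventually_elim (rule sigma2_stress_change[symmetric])
  have "((\<lambda>y. (s y)\<^sup>2 *\<^sub>R W y) has_derivative (\<lambda>h. (s x)\<^sup>2 *\<^sub>R DW h + (2 * s x * Ds h) *\<^sub>R W x)) (at x)"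
    by (rule has_derivative_eq_rhs[OF has_derivative_scaleR[OF has_derivative_power[OF Ds(1)] DW]])
       (simp add: fun_eq_iff)
  from has_derivative_transform_nhds[OF this W']
  have DW': "((\<lambda>y. jacobian f (at y) ** sigma2_stress G' H f y) has_derivative
      (\<lambda>h. (s x)\<^sup>2 *\<^sub>R DW h + (2 * s x * Ds h) *\<^sub>R W x)) (at x)" .
  have W'_x: "jacobian f (at x) ** sigma2_stress G' H f x = (s x)\<^sup>2 *\<^sub>R W x"
    by (rule eventually_nhds_x_imp_x[OF W', symmetric])
  let ?J = "jacobian f (at x)" and ?\<gamma> = "\<chi> k. trace (matrix_inv (G x) ** D (axis k 1)) / 2"
  have T: "sigma2_tension G H f x =
    (\<Sum>a\<in>UNIV. DW (axis a 1) *v axis a 1 + christoffel H (f x) (?J *v axis a 1) (W x *v axis a 1)) + W x *v ?\<gamma>"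
    using sigma2_tension_eq_divergence[OF spd D J' H' DW[unfolded W_def[abs_def]]] by (simp add: W_def)
  have \<gamma>': "(\<chi> k. trace (matrix_inv (G' x) ** D' (axis k 1)) / 2) = ?\<gamma> + (\<chi> k. Du (axis k 1))"
    by (simp add: vol vec_eq_iff)
  have T': "sigma2_tension G' H f x = (\<Sum>a\<in>UNIV. ((s x)\<^sup>2 *\<^sub>R DW (axis a 1) + (2 * s x * Ds (axis a 1)) *\<^sub>R W x) *v axis a 1
        + christoffel H (f x) (?J *v axis a 1) ((s x)\<^sup>2 *\<^sub>R W x *v axis a 1))
      + (s x)\<^sup>2 *\<^sub>R W x *v (?\<gamma> + (\<chi> k. Du (axis k 1)))"
    using sigma2_tension_eq_divergence[OF spd' D' J' H' DW'] unfolding W'_x \<gamma>' .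
  have Ds_sum: "(\<Sum>a\<in>UNIV. (2 * s x * Ds (axis a 1)) *\<^sub>R (W x *v axis a 1)) =
      (s x)\<^sup>2 *\<^sub>R (W x *v (\<chi> k. 2 * Ds (axis k 1) / s x))"
  proof -
    have "(\<chi> k. 2 * Ds (axis k 1) / s x) = (\<Sum>a\<in>UNIV. (2 * Ds (axis a 1) / s x) *\<^sub>R axis a 1)"
      using basis_expansion[of "\<chi> k. 2 * Ds (axis k 1) / s x"] by (simp add: scalar_mult_eq_scaleR)
    then show ?thesis
      using Ds(2) by (simp add: linear_sum[OF matrix_vector_mul_linear] matrix_vector_mult_linear_simps
          scaleR_sum_right power2_eq_square mult_ac)
  qed
  have "sigma2_tension G' H f x = (s x)\<^sup>2 *\<^sub>R (sigma2_tension G H f x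
      + W x *v ((\<chi> k. 2 * Ds (axis k 1) / s x) + (\<chi> k. Du (axis k 1))))"
    unfolding T T'
    by (simp add: matrix_vector_mult_linear_simps sum.distrib Ds_sum scaleR_add_right scaleR_sum_right
        bilinear_rmul[OF bilinear_christoffel])
  also have "(\<chi> k. 2 * Ds (axis k 1) / s x) + (\<chi> k. Du (axis k 1)) = (\<chi> k. partial k w x)"
    by (simp add: vec_eq_iff partial_eq[OF w])
  \<comment> \<open>Unfolding the stress turns its part \<open>2 e P\<close> into the gradient and
    its part \<open>C P\<close> into the weighted gradient.\<close>
  also have "W x *v (\<chi> k. partial k w x) =
      (2 * energy_density G H f x) *\<^sub>R (?J *v gradient G w x) - ?J *v weighted_gradient G H f w x"
    by (simp add: W_def sigma2_stress_def gradient_def weighted_gradient_def matrix_mult_linear_simps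
        matrix_vector_mult_linear_simps matrix_vector_mul_assoc matrix_mul_assoc)
  finally show ?thesis by (simp add: add_diff_eq)
qed

section \<open>Metrics rescaled along a projection\<close>

lemma form_congruence: "form S (B *v u) (B *v v) = form (transpose B ** S ** B) u v"
  using dot_lmul_matrix[of u "transpose B" "S *v (B *v v)"]
  by (simp add: form_def matrix_vector_mul_assoc[symmetric] del: transpose_matrix_vector)

text \<open>Self-adjointness lets \<Theta> pass through \<open>S\<close>, and idempotence absorbs
  the second copy. The left-hand sides are the Gram matrices of \<open>S\<close> restricted along
  the two projections.\<close>

lemma projection_congruence:
  fixes S \<Theta> :: "real^'m^'m"
  assumes S: "transpose S = S" and sym: "transpose (S ** \<Theta>) = S ** \<Theta>" and idem: "\<Theta> ** \<Theta> = \<Theta>"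
  shows "transpose \<Theta> ** S ** \<Theta> = S ** \<Theta>"
    and "transpose (mat 1 - \<Theta>) ** S ** (mat 1 - \<Theta>) = S - S ** \<Theta>"
proof -
  have \<Theta>: "transpose \<Theta> ** S = S ** \<Theta>"
    using sym by (simp add: matrix_transpose_mul S)
  have absorb: "S ** \<Theta> ** \<Theta> = S ** \<Theta>"
    by (simp add: matrix_mul_assoc[symmetric] idem)
  show "transpose \<Theta> ** S ** \<Theta> = S ** \<Theta>"
    by (simp add: \<Theta> absorb)
  show "transpose (mat 1 - \<Theta>) ** S ** (mat 1 - \<Theta>) = S - S ** \<Theta>"
    by (simp add: transpose_linear_simps matrix_mult_linear_simps \<Theta> absorb)
qed

text \<open>The form at \<open>v\<close> splits into \<open>a\<close> times the square length of
  \<open>\<Theta> *v v\<close> plus \<open>b\<close> times that of the complementary component;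
  these do not both vanish unless \<open>v\<close> does.\<close>

lemma spd_rescale:
  fixes S \<Theta> :: "real^'m^'m"
  assumes "spd S" and sym: "transpose (S ** \<Theta>) = S ** \<Theta>" and idem: "\<Theta> ** \<Theta> = \<Theta>"
    and pos: "a > 0" "b > 0"
  shows "spd (S ** (a *\<^sub>R \<Theta> + b *\<^sub>R (mat 1 - \<Theta>)))"
proof -
  have S: "transpose S = S" using assms(1) by (simp add: spd_def)
  have eq: "S ** (a *\<^sub>R \<Theta> + b *\<^sub>R (mat 1 - \<Theta>)) = a *\<^sub>R (S ** \<Theta>) + b *\<^sub>R (S - S ** \<Theta>)"
    by (simp add: matrix_mult_linear_simps)
  have nonneg: "form S u u \<ge> 0" for u
    using assms(1) by (cases "u = 0") (auto simp: spd_def form_def less_imp_le)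
  have "form (S ** (a *\<^sub>R \<Theta> + b *\<^sub>R (mat 1 - \<Theta>))) v v > 0" if "v \<noteq> 0" for v
  proof -
    have "form (S ** (a *\<^sub>R \<Theta> + b *\<^sub>R (mat 1 - \<Theta>))) v v =
        a * form (S ** \<Theta>) v v + b * form (S - S ** \<Theta>) v v"
      unfolding eq by (simp add: form_def matrix_vector_mult_linear_simps inner_add_right)
    also have "\<dots> = a * form S (\<Theta> *v v) (\<Theta> *v v) + b * form S (v - \<Theta> *v v) (v - \<Theta> *v v)"
      using form_congruence[of S \<Theta> v v] form_congruence[of S "mat 1 - \<Theta>" v v]
      by (simp add: projection_congruence[OF S sym idem] matrix_vector_mult_linear_simps)
    also have "\<dots> > 0"
    proof (cases "\<Theta> *v v = 0")
      case True
      then show ?thesis using that assms(1) pos nonneg by (simp add: spd_def form_def)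
    next
      case False
      then have "form S (\<Theta> *v v) (\<Theta> *v v) > 0" using assms(1) by (simp add: spd_def)
      then show ?thesis using pos nonneg by (simp add: add_pos_nonneg)
    qed
    finally show ?thesis .
  qed
  moreover have "transpose (S ** (a *\<^sub>R \<Theta> + b *\<^sub>R (mat 1 - \<Theta>))) = S ** (a *\<^sub>R \<Theta> + b *\<^sub>R (mat 1 - \<Theta>))"
    unfolding eq by (simp only: transpose_linear_simps sym S)
  ultimately show ?thesis by (simp add: spd_def)
qed

text \<open>The conformal change is the case \<open>\<Theta> = mat 1\<close> and \<open>r = CARD('m)\<close>.\<close>

lemma sigma2_tension_biconformal:
  fixes G G' \<Theta> :: "real^'m \<Rightarrow> real^'m^'m" and H :: "real^'n \<Rightarrow> real^'n^'n" and f :: "real^'m \<Rightarrow> real^'n"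
  assumes spd: "\<forall>\<^sub>F y in nhds x. spd (G y)" and G: "G differentiable (at x)"
    and J': "(\<lambda>y. jacobian f (at y)) differentiable (at x)"
    and H': "(\<lambda>y. H (f y)) differentiable (at x)"
    and \<Theta>': "\<Theta> differentiable (at x)"
    and proj: "\<forall>\<^sub>F y in nhds x. transpose (G y ** \<Theta> y) = G y ** \<Theta> y \<and> \<Theta> y ** \<Theta> y = \<Theta> y \<and>
        jacobian f (at y) ** \<Theta> y = jacobian f (at y) \<and> trace (\<Theta> y) = r"
    and \<sigma>': "\<sigma> differentiable (at x)" and \<rho>': "\<rho> differentiable (at x)"
    and pos: "\<forall>\<^sub>F y in nhds x. \<sigma> y > 0 \<and> \<rho> y > 0"
    and G': "\<forall>\<^sub>F y in nhds x. G' y = G y ** (\<sigma> y powi (-2) *\<^sub>R \<Theta> y + \<rho> y powi (-2) *\<^sub>R (mat 1 - \<Theta> y))"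
    and w: "\<forall>\<^sub>F y in nhds x. w y = (4 - r) * ln (\<sigma> y) + (r - real CARD('m)) * ln (\<rho> y)"
  shows "sigma2_tension G' H f x = \<sigma> x ^ 4 *\<^sub>R (sigma2_tension G H f x
      + (2 * energy_density G H f x) *\<^sub>R (jacobian f (at x) *v gradient G w x)
      - jacobian f (at x) *v weighted_gradient G H f w x)"
proof -
  obtain D where D: "(G has_derivative D) (at x)" using G unfolding differentiable_def by blast
  obtain D\<Theta> where D\<Theta>: "(\<Theta> has_derivative D\<Theta>) (at x)" using \<Theta>' unfolding differentiable_def by blast
  obtain D\<sigma> where D\<sigma>: "(\<sigma> has_derivative D\<sigma>) (at x)" using \<sigma>' unfolding differentiable_def by blast
  obtain D\<rho> where D\<rho>: "(\<rho> has_derivative D\<rho>) (at x)" using \<rho>' unfolding differentiable_def by blast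
  have pos_x: "\<sigma> x > 0" "\<rho> x > 0" using eventually_nhds_x_imp_x[OF pos] by auto
  have idem: "\<Theta> x ** \<Theta> x = \<Theta> x" and tr: "trace (\<Theta> x) = r"
    using eventually_nhds_x_imp_x[OF proj] by auto
  have sum_idem: "\<forall>\<^sub>F y in nhds x. \<Theta> y ** \<Theta> y = \<Theta> y" and sum_tr: "\<forall>\<^sub>F y in nhds x. trace (\<Theta> y) = r"
    using proj by (auto elim: eventually_mono)
  have D_idem: "D\<Theta> h = \<Theta> x ** D\<Theta> h + D\<Theta> h ** \<Theta> x" for h
    using has_derivative_unique[OF D\<Theta> has_derivative_transform_nhds[OF has_derivative_matrix_mult[OF D\<Theta> D\<Theta>] sum_idem]]
    by (rule fun_cong)
  \<comment> \<open>\<open>\<Theta>\<close> has constant rank, so its derivative is off-diagonal with respect to the splitting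
      and does not contribute to the change of the volume form.\<close>
  have tr_D: "trace (D\<Theta> h) = 0" for h
    using has_derivative_unique[OF has_derivative_const[of r] has_derivative_transform_nhds[OF
          bounded_linear.has_derivative[OF bounded_linear_trace D\<Theta>] sum_tr]]
    by (metis)
  have tr_\<Theta>D: "trace (\<Theta> x ** D\<Theta> h) = 0" for h
    using arg_cong[OF D_idem[of h], of trace] trace_mul_sym[of "D\<Theta> h" "\<Theta> x"]
    by (simp add: trace_add tr_D)
  define a where "a y = inverse ((\<sigma> y)\<^sup>2)" for y
  define b where "b y = inverse ((\<rho> y)\<^sup>2)" for y
  \<comment> \<open>\<open>G' = G Q\<close>, and \<open>R\<close> is the inverse of
    \<open>Q\<close>, since both are scalar on each summand of the splitting.\<close>
  define Q where "Q y = a y *\<^sub>R \<Theta> y + b y *\<^sub>R (mat 1 - \<Theta> y)" for y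
  define R where "R y = (\<sigma> y)\<^sup>2 *\<^sub>R \<Theta> y + (\<rho> y)\<^sup>2 *\<^sub>R (mat 1 - \<Theta> y)" for y
  define Da where "Da h = - 2 * D\<sigma> h / (\<sigma> x) ^ 3" for h
  define Db where "Db h = - 2 * D\<rho> h / (\<rho> x) ^ 3" for h
  have Da: "(a has_derivative Da) (at x)"
    unfolding a_def[abs_def]
    by (rule has_derivative_eq_rhs[OF Deriv.has_derivative_inverse[OF _ has_derivative_power[OF D\<sigma>]]])
       (use pos_x in \<open>auto simp: fun_eq_iff Da_def field_simps power2_eq_square power3_eq_cube\<close>)
  have Db: "(b has_derivative Db) (at x)"
    unfolding b_def[abs_def]
    by (rule has_derivative_eq_rhs[OF Deriv.has_derivative_inverse[OF _ has_derivative_power[OF D\<rho>]]])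
       (use pos_x in \<open>auto simp: fun_eq_iff Db_def field_simps power2_eq_square power3_eq_cube\<close>)
  define DQ where "DQ h = a x *\<^sub>R D\<Theta> h + Da h *\<^sub>R \<Theta> x + (b x *\<^sub>R (0 - D\<Theta> h) + Db h *\<^sub>R (mat 1 - \<Theta> x))" for h
  have DQ: "(Q has_derivative DQ) (at x)"
    unfolding Q_def[abs_def] DQ_def[abs_def]
    by (intro has_derivative_add has_derivative_scaleR has_derivative_diff has_derivative_const Da Db D\<Theta>)
  have G'_Q: "\<forall>\<^sub>F y in nhds x. G y ** Q y = G' y"
    using G' by eventually_elim (simp add: Q_def a_def b_def power_int_minus)
  have inv: "\<forall>\<^sub>F y in nhds x. matrix_inv (G' y) = R y ** matrix_inv (G y)"
    using G'_Q spd proj pos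
  proof eventually_elim
    case (elim y)
    have "Q y ** R y = mat 1"
      using elim by (simp add: Q_def R_def a_def b_def matrix_mult_linear_simps)
    then have "G' y ** (R y ** matrix_inv (G y)) = mat 1"
      by (simp add: elim(1)[symmetric] matrix_mul_assoc[symmetric])
         (simp add: matrix_mul_assoc matrix_inv_right[OF spd_invertible[OF elim(2)]])
    then show ?case by (rule matrix_inv_eqI)
  qed
  have spd': "\<forall>\<^sub>F y in nhds x. spd (G' y)"
    using G'_Q spd proj pos
    by eventually_elim (metis Q_def a_def b_def spd_rescale inverse_positive_iff_positive zero_less_power)
  have D': "(G' has_derivative (\<lambda>h. G x ** DQ h + D h ** Q x)) (at x)"
    by (rule has_derivative_transform_nhds[OF has_derivative_matrix_mult[OF D DQ] G'_Q])
  \<comment> \<open>Since \<open>J\<close> annihilates \<open>mat 1 - \<Theta>\<close>, only the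
    \<sigma> part of \<open>R\<close> is seen by \<open>J\<close>.\<close>
  have flux: "\<forall>\<^sub>F y in nhds x. jacobian f (at y) ** matrix_inv (G' y) =
      (\<sigma> y)\<^sup>2 *\<^sub>R (jacobian f (at y) ** matrix_inv (G y))"
    using inv proj
    by eventually_elim (simp add: R_def matrix_mult_linear_simps matrix_mul_assoc)
  have Ds: "((\<lambda>y. (\<sigma> y)\<^sup>2) has_derivative (\<lambda>h. 2 * \<sigma> x * D\<sigma> h)) (at x)"
    by (rule has_derivative_eq_rhs, rule has_derivative_power[OF D\<sigma>]) (auto simp: fun_eq_iff)
  \<comment> \<open>The differential of the logarithm of the ratio of volume densities: \<Theta> has
    trace \<open>r\<close>, so \<sigma> has exponent \<open>- r\<close> and \<rho> has exponent
    \<open>r - m\<close>.\<close>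
  define Du where "Du h = - r * D\<sigma> h / \<sigma> x - (real CARD('m) - r) * D\<rho> h / \<rho> x" for h
  \<comment> \<open>This is the derivative of \<open>ln (det Q)\<close>; the factor 2 reflects that
    the volume density is the square root of the determinant.\<close>
  have tr_RDQ: "trace (R x ** DQ h) = 2 * Du h" for h
  proof -
    have "trace (R x ** DQ h) = (\<sigma> x)\<^sup>2 * (Da h * r) + (\<rho> x)\<^sup>2 * (Db h * (real CARD('m) - r))"
      unfolding R_def DQ_def
      by (simp add: matrix_mult_linear_simps trace_add trace_sub trace_scaleR idem tr tr_D tr_\<Theta>D trace_I)
    also have "\<dots> = ((\<sigma> x)\<^sup>2 * Da h) * r + ((\<rho> x)\<^sup>2 * Db h) * (real CARD('m) - r)"
      by simp
    also have "(\<sigma> x)\<^sup>2 * Da h = - 2 * D\<sigma> h / \<sigma> x"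
      using pos_x by (simp add: Da_def power2_eq_square power3_eq_cube)
    also have "(\<rho> x)\<^sup>2 * Db h = - 2 * D\<rho> h / \<rho> x"
      using pos_x by (simp add: Db_def power2_eq_square power3_eq_cube)
    finally show ?thesis
      by (simp add: Du_def algebra_simps)
  qed
  have RQ: "Q x ** R x = mat 1"
    using idem pos_x by (simp add: Q_def R_def a_def b_def matrix_mult_linear_simps)
  have inv_G: "matrix_inv (G x) ** G x = mat 1"
    by (rule matrix_inv_left[OF spd_invertible[OF eventually_nhds_x_imp_x[OF spd]]])
  \<comment> \<open>The logarithmic derivative of \<open>det G'\<close> splits into those of
    \<open>det G\<close> and \<open>det Q\<close>; cyclicity of the trace brings \<open>Q\<close>
    next to its inverse \<open>R\<close>.\<close>
  have vol: "trace (matrix_inv (G' x) ** (G x ** DQ h + D h ** Q x)) / 2 =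
      trace (matrix_inv (G x) ** D h) / 2 + Du h" for h
  proof -
    have "trace (matrix_inv (G' x) ** (G x ** DQ h + D h ** Q x)) =
        trace (R x ** ((matrix_inv (G x) ** G x) ** DQ h)) + trace ((R x ** (matrix_inv (G x) ** D h)) ** Q x)"
      by (simp add: eventually_nhds_x_imp_x[OF inv] matrix_mult_linear_simps trace_add matrix_mul_assoc)
    also have "trace ((R x ** (matrix_inv (G x) ** D h)) ** Q x) = trace ((Q x ** R x) ** (matrix_inv (G x) ** D h))"
      by (subst trace_mul_sym) (simp add: matrix_mul_assoc)
    finally show ?thesis by (simp add: inv_G RQ tr_RDQ)
  qed
  \<comment> \<open>With \<open>s\<close> the square of \<sigma>, the term
    \<open>2 * Ds h / s x\<close> is four times the logarithmic derivative of \<sigma>; together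
    with \<open>Du\<close> this gives the exponents \<open>4 - r\<close> and
    \<open>r - m\<close>.\<close>
  have "((\<lambda>y. (4 - r) * ln (\<sigma> y) + (r - real CARD('m)) * ln (\<rho> y)) has_derivative
      (\<lambda>h. 2 * (2 * \<sigma> x * D\<sigma> h) / (\<sigma> x)\<^sup>2 + Du h)) (at x)"
    using pos_x by (auto intro!: derivative_eq_intros D\<sigma> D\<rho> simp: fun_eq_iff Du_def field_simps power2_eq_square)
  then have w': "(w has_derivative (\<lambda>h. 2 * (2 * \<sigma> x * D\<sigma> h) / (\<sigma> x)\<^sup>2 + Du h)) (at x)"
    by (rule has_derivative_transform_nhds) (use w in \<open>rule eventually_mono\<close>, simp)
  from sigma2_tension_change[OF spd D spd' D' J' H' flux Ds _ vol w'] pos_x show ?thesis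
    by (simp add: power_mult[symmetric])
qed

section \<open>Horizontal projections and charts\<close>

text \<open>The form of the inverse at \<open>v\<close> is the form of \<open>S\<close> at
  \<open>matrix_inv S *v v\<close>.\<close>

lemma spd_matrix_inv:
  fixes S :: "real^'m^'m"
  assumes "spd S"
  shows "spd (matrix_inv S)"
proof -
  have inv: "invertible S" and sym: "transpose S = S"
    using assms by (simp_all add: spd_invertible) (simp add: spd_def)
  have "form (matrix_inv S) v v > 0" if "v \<noteq> 0" for v
  proof -
    have v: "S *v (matrix_inv S *v v) = v"
      by (simp add: matrix_vector_mul_assoc matrix_inv_right[OF inv])
    then have "matrix_inv S *v v \<noteq> 0"
      using that by (metis bounded_bilinear.zero_right[OF bounded_bilinear_matrix_vector_mult])
    then have "form S (matrix_inv S *v v) (matrix_inv S *v v) > 0"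
      using assms by (simp add: spd_def)
    then show ?thesis
      by (simp add: form_def v inner_commute)
  qed
  then show ?thesis
    using transpose_matrix_inv[OF inv sym] by (simp add: spd_def)
qed

lemma form_axis: "form S (axis i 1) (axis j 1) = S $ i $ j"
  by (simp add: form_def inner_axis' matrix_vector_mult_basis column_def)

text \<open>The \<open>S\<close>-orthogonal projection along the kernel of \<open>J\<close>, for
  surjective \<open>J\<close>: a weighted pseudo-inverse of \<open>J\<close> followed by composition
  with \<open>J\<close>. The closed formula shows that it varies differentiably with
  \<open>S\<close> and \<open>J\<close>.\<close>

definition horizontal_projection :: "real^'m^'m \<Rightarrow> real^'m^'n \<Rightarrow> real^'m^'m" where
  "horizontal_projection S J = matrix_inv S ** transpose J
     ** matrix_inv (J ** matrix_inv S ** transpose J) ** J"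

text \<open>A kernel vector \<open>v\<close> has \<open>transpose J *v v = 0\<close> by positivity
  of the inverse metric. It is thus orthogonal to the range of \<open>J\<close>, which is
  everything.\<close>

lemma invertible_gram:
  fixes J :: "real^'m^'n"
  assumes "spd S" "surj ((*v) J)"
  shows "invertible (J ** matrix_inv S ** transpose J)"
proof -
  have "v = 0" if v: "J ** matrix_inv S ** transpose J *v v = 0" for v
  proof -
    have "form (matrix_inv S) (transpose J *v v) (transpose J *v v) = 0"
      using v form_congruence[of "matrix_inv S" "transpose J" v v] by (simp add: form_def del: transpose_matrix_vector)
    then have J: "v v* J = 0"
      using spd_matrix_inv[OF assms(1)] by (force simp: spd_def)
    obtain u where "v = J *v u" using assms(2) by blast
    then have "v \<bullet> v = (v v* J) \<bullet> u" by (simp add: dot_lmul_matrix)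
    then show ?thesis using J by simp
  qed
  then show ?thesis by (auto simp: invertible_left_inverse matrix_left_invertible_ker)
qed

context
  fixes S :: "real^'m^'m" and J :: "real^'m^'n"
  assumes spd: "spd S" and inv: "invertible (J ** matrix_inv S ** transpose J)"
begin

lemma horizontal_projection_idem:
  "horizontal_projection S J ** horizontal_projection S J = horizontal_projection S J"
proof -
  let ?K = "J ** matrix_inv S ** transpose J"
  have "horizontal_projection S J ** horizontal_projection S J
      = matrix_inv S ** transpose J ** (matrix_inv ?K ** ?K) ** matrix_inv ?K ** J"
    unfolding horizontal_projection_def by (simp only: matrix_mul_assoc)
  then show ?thesis by (simp add: matrix_inv_left[OF inv] horizontal_projection_def)
qed

lemma matrix_mult_horizontal_projection: "J ** horizontal_projection S J = J"
proof -
  let ?K = "J ** matrix_inv S ** transpose J"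
  have "J ** horizontal_projection S J = (?K ** matrix_inv ?K) ** J"
    unfolding horizontal_projection_def by (simp only: matrix_mul_assoc)
  then show ?thesis by (simp add: matrix_inv_right[OF inv])
qed

text \<open>Moving \<open>J\<close> to the front leaves a Gram matrix times its inverse, of size
  \<open>CARD('n)\<close>. This rank is the source of \<open>n\<close> in the exponents.\<close>

lemma trace_horizontal_projection: "trace (horizontal_projection S J) = CARD('n)"
proof -
  let ?K = "J ** matrix_inv S ** transpose J"
  have "trace (horizontal_projection S J) = trace (J ** (matrix_inv S ** transpose J ** matrix_inv ?K))"
    unfolding horizontal_projection_def by (rule trace_mul_sym)
  also have "J ** (matrix_inv S ** transpose J ** matrix_inv ?K) = ?K ** matrix_inv ?K"
    by (simp only: matrix_mul_assoc)
  finally show ?thesis by (simp add: matrix_inv_right[OF inv] trace_I)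
qed

lemma metric_mult_horizontal_projection:
  "S ** horizontal_projection S J = transpose J ** matrix_inv (J ** matrix_inv S ** transpose J) ** J"
  by (simp add: horizontal_projection_def matrix_mul_assoc matrix_inv_right[OF spd_invertible[OF spd]])

lemma transpose_metric_mult_horizontal_projection:
  "transpose (S ** horizontal_projection S J) = S ** horizontal_projection S J"
proof -
  have "transpose (matrix_inv S) = matrix_inv S"
    using spd by (simp add: transpose_matrix_inv spd_invertible spd_def)
  then have "transpose (J ** matrix_inv S ** transpose J) = J ** matrix_inv S ** transpose J"
    by (simp add: matrix_transpose_mul matrix_mul_assoc)
  then show ?thesis
    unfolding metric_mult_horizontal_projection
    by (simp add: matrix_transpose_mul matrix_mul_assoc transpose_matrix_inv[OF inv])
qed

text \<open>Self-adjointness moves the projection onto \<open>v\<close>, where its last factor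
  \<open>J\<close> gives zero.\<close>

lemma horizontal_projection_orthogonal:
  assumes "J *v v = 0"
  shows "form S (horizontal_projection S J *v u) v = 0"
proof -
  have "form S v (horizontal_projection S J *v u) = (v v* (S ** horizontal_projection S J)) \<bullet> u"
    by (simp add: form_def matrix_vector_mul_assoc dot_lmul_matrix)
  also have "v v* (S ** horizontal_projection S J) = transpose (S ** horizontal_projection S J) *v v"
    by simp
  also have "\<dots> = 0"
    unfolding transpose_metric_mult_horizontal_projection unfolding metric_mult_horizontal_projection
    by (simp add: matrix_vector_mul_assoc[symmetric] assms)
  finally show ?thesis using spd by (simp add: form_commute[of S] spd_def)
qed

text \<open>The difference \<open>z\<close> of two candidates lies in the kernel. It is also the
  difference of two vectors orthogonal to the kernel, so its square length vanishes. This settles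
  the definite description in \<open>vertical_part\<close>.\<close>

lemma vertical_component_unique:
  assumes w: "J *v w = 0" and orth: "\<And>v. J *v v = 0 \<Longrightarrow> form S (u - w) v = 0"
  shows "w = u - horizontal_projection S J *v u"
proof -
  define z where "z = w - (u - horizontal_projection S J *v u)"
  have ker: "J *v z = 0"
    by (simp add: z_def w matrix_vector_mult_linear_simps matrix_vector_mul_assoc
        matrix_mult_horizontal_projection)
  have "form S z z = form S (horizontal_projection S J *v u) z - form S (u - w) z"
    by (simp add: z_def form_def inner_diff_left inner_add_left)
  then have "form S z z = 0"
    using horizontal_projection_orthogonal[OF ker] orth[OF ker] by simp
  then have "z = 0" using spd unfolding spd_def by (metis less_irrefl)
  then show ?thesis by (simp add: z_def)
qed

end

section \<open>Local representatives in charts\<close>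

lemma smooth_on_differentiable:
  assumes "smooth_on f S" "x \<in> S"
  shows "f differentiable (at x)"
proof -
  have "Ck_on (Suc 0) f S" using assms(1) by (simp only: smooth_on_def)
  then show ?thesis using assms(2) by simp
qed

lemma smooth_on_jacobian_differentiable:
  fixes f :: "real^'m \<Rightarrow> real^'n"
  assumes "smooth_on f S" "x \<in> S"
  shows "(\<lambda>y. jacobian f (at y)) differentiable (at x)"
proof -
  have "Ck_on (Suc (Suc 0)) f S" using assms(1) by (simp only: smooth_on_def)
  then have D: "(\<lambda>y. frechet_derivative f (at y) v) differentiable (at x)" for v
    using assms(2) by simp
  have "(\<lambda>y. frechet_derivative f (at y) (axis j 1) $ i) differentiable (at x)" for i j
    using bounded_linear.has_derivative[OF bounded_linear_vec_nth[of i]] D[of "axis j 1"]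
    unfolding differentiable_def by blast
  then show ?thesis
    unfolding jacobian_def matrix_def by (intro differentiable_vec_lambda)
qed

lemma chart_inv_left:
  assumes "is_chart X c" "p \<in> fst c"
  shows "chart_inv c (snd c p) = p"
proof -
  have "topspace (subtopology X (fst c)) = fst c"
    using assms(1) openin_subset by (fastforce simp: is_chart_def)
  then have "inj_on (snd c) (fst c)"
    using assms(1) homeomorphic_imp_injective_map unfolding is_chart_def by metis
  then show ?thesis using assms(2) by (simp add: chart_inv_def)
qed

definition rep_domain :: "('a, 'm::finite) chart \<Rightarrow> ('b, 'n::finite) chart \<Rightarrow> ('a \<Rightarrow> 'b) \<Rightarrow> (real^'m) set" where
  "rep_domain c d \<phi> = snd c ` {p \<in> fst c. \<phi> p \<in> fst d}"

lemma rep_domain: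
  assumes "smooth_map X A Y B \<phi>" "c \<in> A" "d \<in> B"
  shows "open (rep_domain c d \<phi>)" "smooth_on (local_rep c d \<phi>) (rep_domain c d \<phi>)"
  using assms by (auto simp: smooth_map_def smooth_on_def rep_domain_def)

lemma rep_domain_point:
  assumes "is_chart X c" "y \<in> rep_domain c d \<phi>"
  shows "y \<in> chart_image c" "chart_inv c y \<in> fst c" "\<phi> (chart_inv c y) \<in> fst d"
    "snd c (chart_inv c y) = y"
    "local_rep c d \<phi> y = snd d (\<phi> (chart_inv c y))" "local_rep c d \<phi> y \<in> chart_image d"
  using assms(2) chart_inv_left[OF assms(1)]
  by (auto simp: rep_domain_def chart_image_def local_rep_def)

lemma riemannian_manifold_chart:
  assumes "riemannian_manifold X A g" "c \<in> A"
  shows "is_chart X c" "smooth_on (g c) (chart_image c)" "y \<in> chart_image c \<Longrightarrow> spd (g c y)"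
  using assms by (auto simp: riemannian_manifold_def smooth_manifold_def spd_def)

context
  fixes X :: "'a topology" and A :: "('a, 'm::finite) chart set" and g :: "('a, 'm) metric"
    and Y :: "'b topology" and B :: "('b, 'n::finite) chart set" and h :: "('b, 'n) metric"
    and \<phi> :: "'a \<Rightarrow> 'b" and c d
  assumes M: "riemannian_manifold X A g" and N: "riemannian_manifold Y B h"
    and \<phi>: "smooth_map X A Y B \<phi>" and c: "c \<in> A" and d: "d \<in> B"
begin

text \<open>\<open>vertical\<close> quantifies over all charts of the target around the image point.
  By the chain rule another chart only composes the differential with that of a transition map, so
  the single chart \<open>d\<close> decides.\<close>

lemma vertical_eq_kernel:
  assumes y: "y \<in> rep_domain c d \<phi>"
  shows "vertical B \<phi> c (chart_inv c y) = {v. jacobian (local_rep c d \<phi>) (at y) *v v = 0}"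
proof -
  note pt = rep_domain_point[OF riemannian_manifold_chart(1)[OF M c] y]
  let ?f = "local_rep c d \<phi>"
  have f': "?f differentiable (at y)"
    using rep_domain(2)[OF \<phi> c d] y by (rule smooth_on_differentiable)
  then have jac: "frechet_derivative ?f (at y) v = jacobian ?f (at y) *v v" for v
    unfolding jacobian_works by (metis frechet_derivative_at)
  have "frechet_derivative (local_rep c d' \<phi>) (at y) v = 0"
    if d': "d' \<in> charts_at B (\<phi> (chart_inv c y))" and v: "frechet_derivative ?f (at y) v = 0" for d' v
  proof -
    let ?t = "snd d' \<circ> chart_inv d"
    have d'B: "d' \<in> B" "\<phi> (chart_inv c y) \<in> fst d'" using d' by (auto simp: charts_at_def)
    have "smooth_on ?t (snd d ` (fst d \<inter> fst d'))"
      using N d d'B by (auto simp: riemannian_manifold_def smooth_manifold_def)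
    moreover have "?f y \<in> snd d ` (fst d \<inter> fst d')" using pt d'B by auto
    ultimately have t: "?t differentiable (at (?f y))" by (rule smooth_on_differentiable)
    have eq: "(?t \<circ> ?f) z = local_rep c d' \<phi> z" if "z \<in> rep_domain c d \<phi>" for z
      using rep_domain_point[OF riemannian_manifold_chart(1)[OF M c] that] chart_inv_left[OF riemannian_manifold_chart(1)[OF N d]]
      by (simp add: local_rep_def)
    have "frechet_derivative (local_rep c d' \<phi>) (at y) = frechet_derivative (?t \<circ> ?f) (at y)"
      by (rule frechet_derivative_transform_within_open[symmetric, OF _ rep_domain(1)[OF \<phi> c d] y eq])
        (intro differentiable_chain_at f' t)
    also have "\<dots> = frechet_derivative ?t (at (?f y)) \<circ> frechet_derivative ?f (at y)"
      by (rule frechet_derivative_compose[OF f' t])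
    finally show ?thesis
      using v linear_0[OF linear_frechet_derivative[OF t]] by simp
  qed
  moreover have "d \<in> charts_at B (\<phi> (chart_inv c y))" using pt d by (simp add: charts_at_def)
  ultimately have "vertical B \<phi> c (chart_inv c y) = {v. frechet_derivative ?f (at y) v = 0}"
    unfolding vertical_def pt(4) by blast
  then show ?thesis by (simp add: jac)
qed

text \<open>The vertical part is \<open>mat 1 - \<Theta>\<close> by existence and uniqueness of the
  orthogonal decomposition; \<open>projection_congruence\<close> then collapses the two Gram
  matrices into one product.\<close>

lemma biconformal_metric_eq:
  assumes y: "y \<in> rep_domain c d \<phi>"
  defines "J \<equiv> jacobian (local_rep c d \<phi>) (at y)"
  defines "\<Theta> \<equiv> horizontal_projection (g c y) J"
  assumes inv: "invertible (J ** matrix_inv (g c y) ** transpose J)"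
  shows "biconformal_metric B \<phi> \<sigma> \<rho> g c y =
    g c y ** (\<sigma> (chart_inv c y) powi (-2) *\<^sub>R \<Theta> + \<rho> (chart_inv c y) powi (-2) *\<^sub>R (mat 1 - \<Theta>))"
proof -
  note pt = rep_domain_point[OF riemannian_manifold_chart(1)[OF M c] y] and kernel = vertical_eq_kernel[OF y, folded J_def]
  have spd: "spd (g c y)" by (rule riemannian_manifold_chart(3)[OF M c pt(1)])
  then have sym: "transpose (g c y) = g c y" by (simp add: spd_def)
  have ver: "vertical_part B \<phi> g c (chart_inv c y) u = (mat 1 - \<Theta>) *v u" for u
    unfolding vertical_part_def
  proof (rule the_equality)
    have "J *v (u - \<Theta> *v u) = 0"
      by (simp add: \<Theta>_def matrix_vector_mult_linear_simps matrix_vector_mul_assoc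
          matrix_mult_horizontal_projection[OF spd inv])
    then show "(mat 1 - \<Theta>) *v u \<in> vertical B \<phi> c (chart_inv c y) \<and>
        u - (mat 1 - \<Theta>) *v u \<in> horizontal B \<phi> g c (chart_inv c y)"
      by (simp add: kernel horizontal_def pt(4) matrix_vector_mult_linear_simps
          horizontal_projection_orthogonal[OF spd inv] \<Theta>_def)
  next
    fix w
    assume "w \<in> vertical B \<phi> c (chart_inv c y) \<and> u - w \<in> horizontal B \<phi> g c (chart_inv c y)"
    then have "w = u - \<Theta> *v u"
      unfolding \<Theta>_def by (intro vertical_component_unique[OF spd inv]) (auto simp: kernel horizontal_def pt(4))
    then show "w = (mat 1 - \<Theta>) *v u" by (simp add: matrix_vector_mult_linear_simps)
  qed
  have hor: "horizontal_part B \<phi> g c (chart_inv c y) u = \<Theta> *v u" for u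
    by (simp add: horizontal_part_def ver matrix_vector_mult_linear_simps)
  note congr = projection_congruence[OF sym
      transpose_metric_mult_horizontal_projection[OF spd inv] horizontal_projection_idem[OF spd inv],
      folded \<Theta>_def]
  show ?thesis
    unfolding biconformal_metric_def Let_def hor ver form_congruence congr form_axis
    by (simp add: vec_eq_iff matrix_mult_linear_simps)
qed

end

section \<open>From the formula in charts to the manifold\<close>

lemma ln_powi: "x > 0 \<Longrightarrow> ln (x powi k) = real_of_int k * ln (x::real)"
  using powr_real_of_int'[of x k] ln_powr[of x "real_of_int k"] by simp

theorem theorem3p2:
  fixes X :: "'a topology" and A :: "('a, 'm::finite) chart set" and g :: "('a, 'm) metric"
    and Y :: "'b topology" and B :: "('b, 'n::finite) chart set" and h :: "('b, 'n) metric"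
    and \<phi> :: "'a \<Rightarrow> 'b" and \<sigma> \<rho> :: "'a \<Rightarrow> real"
  assumes "riemannian_manifold X A g" and "riemannian_manifold Y B h"
    and "almost_submersion X A Y B \<phi>"
    and "smooth_function A \<sigma>" and "\<forall>p\<in>topspace X. \<sigma> p > 0"
    and "smooth_function A \<rho>" and "\<forall>p\<in>topspace X. \<rho> p > 0"
  shows "(\<forall>p\<in>topspace X. submersion_at A B \<phi> p \<longrightarrow>
            (\<forall>c\<in>charts_at A p. \<forall>d\<in>charts_at B (\<phi> p).
              (let x = snd c p; f = local_rep c d \<phi>; G = g c; H = h d;
                   w = (\<lambda>q. ln (\<sigma> q powi (4 - int CARD('n)) *
                                  \<rho> q powi (int CARD('n) - int CARD('m)))) \<circ> chart_inv c
               in sigma2_tension (biconformal_metric B \<phi> \<sigma> \<rho> g c) H f x =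
                    \<sigma> p ^ 4 *\<^sub>R
                      (sigma2_tension G H f x
                       + (2 * energy_density G H f x) *\<^sub>R (jacobian f (at x) *v gradient G w x)
                       - jacobian f (at x) *v weighted_gradient G H f w x))))
       \<and> (\<forall>p\<in>topspace X.
            \<forall>c\<in>charts_at A p. \<forall>d\<in>charts_at B (\<phi> p).
              (let x = snd c p; f = local_rep c d \<phi>; G = g c; H = h d;
                   w = (\<lambda>q. ln (\<sigma> q powi (4 - int CARD('m)))) \<circ> chart_inv c
               in sigma2_tension (conformal_metric \<sigma> g c) H f x =
                    \<sigma> p ^ 4 *\<^sub>R
                      (sigma2_tension G H f x
                       + (2 * energy_density G H f x) *\<^sub>R (jacobian f (at x) *v gradient G w x)
                       - jacobian f (at x) *v weighted_gradient G H f w x)))"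
proof (rule conjI; intro ballI impI)
  have \<phi>: "smooth_map X A Y B \<phi>" using assms(3) by (simp add: almost_submersion_def)
  \<comment> \<open>Local data shared by both claims. As \<open>rep_domain\<close> is open,
    pointwise facts on it hold near \<open>snd c p\<close>.\<close>
  have chart:
    "snd c p \<in> rep_domain c d \<phi>" "chart_inv c (snd c p) = p"
    "\<forall>\<^sub>F y in nhds (snd c p). y \<in> rep_domain c d \<phi>"
    "\<forall>\<^sub>F y in nhds (snd c p). spd (g c y)" "g c differentiable (at (snd c p))"
    "(\<lambda>y. jacobian (local_rep c d \<phi>) (at y)) differentiable (at (snd c p))"
    "(\<lambda>y. h d (local_rep c d \<phi> y)) differentiable (at (snd c p))"
    "(\<sigma> \<circ> chart_inv c) differentiable (at (snd c p))" "(\<rho> \<circ> chart_inv c) differentiable (at (snd c p))"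
    "\<forall>\<^sub>F y in nhds (snd c p). (\<sigma> \<circ> chart_inv c) y > 0 \<and> (\<rho> \<circ> chart_inv c) y > 0"
    "local_rep c d \<phi> differentiable (at (snd c p))"
    if p: "p \<in> topspace X" and cp: "c \<in> charts_at A p" and dp: "d \<in> charts_at B (\<phi> p)" for p c d
  proof -
    have c: "c \<in> A" "p \<in> fst c" and d: "d \<in> B" "\<phi> p \<in> fst d"
      using cp dp by (auto simp: charts_at_def)
    note M_chart = riemannian_manifold_chart[OF assms(1) c(1)]
      and N_chart = riemannian_manifold_chart[OF assms(2) d(1)]
      and pt = rep_domain_point[where d = d and \<phi> = \<phi>, OF M_chart(1)]
      and dom = rep_domain[OF \<phi> c(1) d(1)]
    show x: "snd c p \<in> rep_domain c d \<phi>" using c d by (auto simp: rep_domain_def)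
    show "chart_inv c (snd c p) = p" using chart_inv_left[OF M_chart(1)] c by simp
    show ev: "\<forall>\<^sub>F y in nhds (snd c p). y \<in> rep_domain c d \<phi>"
      using dom(1) x by (rule eventually_nhds_in_open)
    show "\<forall>\<^sub>F y in nhds (snd c p). spd (g c y)"
      using ev by eventually_elim (rule M_chart(3)[OF pt(1)])
    show "g c differentiable (at (snd c p))"
      by (rule smooth_on_differentiable[OF M_chart(2) pt(1)[OF x]])
    show "(\<lambda>y. jacobian (local_rep c d \<phi>) (at y)) differentiable (at (snd c p))"
      by (rule smooth_on_jacobian_differentiable[OF dom(2) x])
    show f': "local_rep c d \<phi> differentiable (at (snd c p))"
      by (rule smooth_on_differentiable[OF dom(2) x])
    show "(\<lambda>y. h d (local_rep c d \<phi> y)) differentiable (at (snd c p))"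
      using differentiable_chain_at[OF f' smooth_on_differentiable[OF N_chart(2) pt(6)[OF x]]]
      by (simp add: o_def)
    show "(\<sigma> \<circ> chart_inv c) differentiable (at (snd c p))" "(\<rho> \<circ> chart_inv c) differentiable (at (snd c p))"
      using assms(4,6) c(1) smooth_on_differentiable[OF _ pt(1)[OF x]] by (auto simp: smooth_function_def)
    have sub: "fst c \<subseteq> topspace X" using M_chart(1) openin_subset by (auto simp: is_chart_def)
    show "\<forall>\<^sub>F y in nhds (snd c p). (\<sigma> \<circ> chart_inv c) y > 0 \<and> (\<rho> \<circ> chart_inv c) y > 0"
      using ev by eventually_elim (use assms(5,7) sub pt(2) in auto)
  qed
  {
    fix p c d
    assume p: "p \<in> topspace X" "c \<in> charts_at A p" "d \<in> charts_at B (\<phi> p)" and sub: "submersion_at A B \<phi> p"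
    note chart = chart[OF p]
    have c: "c \<in> A" and d: "d \<in> B" using p by (auto simp: charts_at_def)
    let ?x = "snd c p" and ?J = "\<lambda>y. jacobian (local_rep c d \<phi>) (at y)"
    let ?K = "\<lambda>y. ?J y ** matrix_inv (g c y) ** transpose (?J y)"
    have spd_x: "spd (g c ?x)" using chart(4) by (rule eventually_nhds_x_imp_x)
    have P': "(\<lambda>y. matrix_inv (g c y)) differentiable (at ?x)"
      by (rule differentiable_matrix_inv[OF chart(5) spd_invertible[OF spd_x]])
    have "surj (frechet_derivative (local_rep c d \<phi>) (at ?x))"
      using sub p by (simp add: submersion_at_def)
    also have "frechet_derivative (local_rep c d \<phi>) (at ?x) = (*v) (?J ?x)"
      using chart(11) unfolding jacobian_works by (rule frechet_derivative_at[symmetric])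
    \<comment> \<open>The submersion property is given at \<open>p\<close> only. Invertibility of
      the Gram matrix is an open condition, so the projection formula stays valid near
      \<open>snd c p\<close>, where it has to be differentiated.\<close>
    finally have K: "invertible (?K ?x)" by (rule invertible_gram[OF spd_x])
    have K': "?K differentiable (at ?x)"
      by (intro differentiable_matrix_mult differentiable_transpose P' chart(6))
    note ev_K = eventually_invertible[OF K' K]
    have \<Theta>': "(\<lambda>y. horizontal_projection (g c y) (?J y)) differentiable (at ?x)"
      unfolding horizontal_projection_def
      by (intro differentiable_matrix_mult differentiable_transpose P' chart(6) differentiable_matrix_inv K K')
    show "let x = snd c p; f = local_rep c d \<phi>; G = g c; H = h d;
                   w = (\<lambda>q. ln (\<sigma> q powi (4 - int CARD('n)) *
                                  \<rho> q powi (int CARD('n) - int CARD('m)))) \<circ> chart_inv c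
               in sigma2_tension (biconformal_metric B \<phi> \<sigma> \<rho> g c) H f x =
                    \<sigma> p ^ 4 *\<^sub>R
                      (sigma2_tension G H f x
                       + (2 * energy_density G H f x) *\<^sub>R (jacobian f (at x) *v gradient G w x)
                       - jacobian f (at x) *v weighted_gradient G H f w x)"
      unfolding Let_def
    proof (rule sigma2_tension_biconformal[where \<sigma> = "\<sigma> \<circ> chart_inv c" and \<rho> = "\<rho> \<circ> chart_inv c"
          and x = ?x and r = "CARD('n)", unfolded o_apply[of \<sigma> _ ?x] chart(2),
          OF chart(4-7) \<Theta>' _ chart(8-10)])
      show "\<forall>\<^sub>F y in nhds ?x. transpose (g c y ** horizontal_projection (g c y) (?J y))
            = g c y ** horizontal_projection (g c y) (?J y) \<and>
          horizontal_projection (g c y) (?J y) ** horizontal_projection (g c y) (?J y)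
            = horizontal_projection (g c y) (?J y) \<and>
          ?J y ** horizontal_projection (g c y) (?J y) = ?J y \<and>
          trace (horizontal_projection (g c y) (?J y)) = CARD('n)"
        using chart(4) ev_K
        by eventually_elim (simp add: transpose_metric_mult_horizontal_projection
            horizontal_projection_idem matrix_mult_horizontal_projection trace_horizontal_projection)
      show "\<forall>\<^sub>F y in nhds ?x. biconformal_metric B \<phi> \<sigma> \<rho> g c y =
          g c y ** ((\<sigma> \<circ> chart_inv c) y powi (-2) *\<^sub>R horizontal_projection (g c y) (?J y)
            + (\<rho> \<circ> chart_inv c) y powi (-2) *\<^sub>R (mat 1 - horizontal_projection (g c y) (?J y)))"
        using chart(3) ev_K
        unfolding o_apply by eventually_elim (rule biconformal_metric_eq[OF assms(1,2) \<phi> c d])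
      show "\<forall>\<^sub>F y in nhds ?x. ((\<lambda>q. ln (\<sigma> q powi (4 - int CARD('n)) *
              \<rho> q powi (int CARD('n) - int CARD('m)))) \<circ> chart_inv c) y =
          (4 - real CARD('n)) * ln ((\<sigma> \<circ> chart_inv c) y)
          + (real CARD('n) - real CARD('m)) * ln ((\<rho> \<circ> chart_inv c) y)"
        using chart(10) by eventually_elim (simp add: ln_mult ln_powi)
    qed
  next
    fix p c d
    assume p: "p \<in> topspace X" "c \<in> charts_at A p" "d \<in> charts_at B (\<phi> p)"
    note chart = chart[OF p]
    show "let x = snd c p; f = local_rep c d \<phi>; G = g c; H = h d;
                   w = (\<lambda>q. ln (\<sigma> q powi (4 - int CARD('m)))) \<circ> chart_inv c
               in sigma2_tension (conformal_metric \<sigma> g c) H f x =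
                    \<sigma> p ^ 4 *\<^sub>R
                      (sigma2_tension G H f x
                       + (2 * energy_density G H f x) *\<^sub>R (jacobian f (at x) *v gradient G w x)
                       - jacobian f (at x) *v weighted_gradient G H f w x)"
      unfolding Let_def
    \<comment> \<open>The identity serves as projection, and \<rho> only enters with coefficient
      zero. Specialising the first claim to equal factors would give the formula at submersion
      points only, whereas here it is claimed everywhere.\<close>
    proof (rule sigma2_tension_biconformal[where \<sigma> = "\<sigma> \<circ> chart_inv c" and \<rho> = "\<rho> \<circ> chart_inv c"
          and x = "snd c p" and r = "CARD('m)", unfolded o_apply[of \<sigma> _ "snd c p"] chart(2),
          OF chart(4-7) differentiable_const _ chart(8-10)])
      show "\<forall>\<^sub>F y in nhds (snd c p). transpose (g c y ** mat 1) = g c y ** mat 1 \<and> mat 1 ** mat 1 = (mat 1 :: real^'m^'m) \<and>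
          jacobian (local_rep c d \<phi>) (at y) ** mat 1 = jacobian (local_rep c d \<phi>) (at y) \<and>
          trace (mat 1 :: real^'m^'m) = real CARD('m)"
        using chart(4) by eventually_elim (simp add: spd_def trace_I)
      show "\<forall>\<^sub>F y in nhds (snd c p). conformal_metric \<sigma> g c y = g c y ** ((\<sigma> \<circ> chart_inv c) y powi (-2) *\<^sub>R mat 1
          + (\<rho> \<circ> chart_inv c) y powi (-2) *\<^sub>R (mat 1 - mat 1))"
        by (simp add: conformal_metric_def matrix_mult_linear_simps)
      show "\<forall>\<^sub>F y in nhds (snd c p). ((\<lambda>q. ln (\<sigma> q powi (4 - int CARD('m)))) \<circ> chart_inv c) y =
          (4 - real CARD('m)) * ln ((\<sigma> \<circ> chart_inv c) y)
          + (real CARD('m) - real CARD('m)) * ln ((\<rho> \<circ> chart_inv c) y)"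
        using chart(10) by eventually_elim (simp add: ln_powi)
    qed
  }
qed

end
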